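(* Let $(W,I)$ be of type $E_7$, and let $J_1,J_2$ be proper connected subsets of $I=\{1,\dots,7\}$. Then $$J_1\star_I J_2=\begin{cases}\{2,5,7\}, & \text{if } J_1=J_2=I-\{1\};\\ \{2,3,4,5\}, & \text{if } J_1=J_2=I-\{7\};\\ \{3,4,5\}, & \text{if } \{J_1,J_2\}=\{I-\{1\},\,I-\{7\}\};\\ \{4\}, & \text{if } \{J_1,J_2\}=\{I-\{7\},\,I-\{1,7\}\};\\ \{4\}, & \text{if } \{J_1,J_2\}=\{I-\{7\},\,I-\{6,7\}\};\\ \emptyset, & \text{otherwise.}\end{cases}$$
   Context: $(W,I)$ is a finite Coxeter group with simple reflections $s_i$ ($i\in I$). The monoid operation $\ast$ on $W$ is determined by $T'_xT'_y=T'_{x\ast y}$ in the $0$-Hecke algebra, where $T'_{s_i}$ satisfy $T'^2_{s_i}=T'_{s_i}$ and the braid relations, and $T'_w=T'_{s_{i_1}}\cdots T'_{s_{i_k}}$ for any reduced expression $w=s_{i_1}\cdots s_{i_k}$; equivalently $s_i\ast w$ is the Bruhat-larger of $w$ and $s_iw$. For $J\subset I$, $w_0^J$ is the longest element of $W_J=\langle s_j: j\in J\rangle$. For $J_1,J_2\subset I$, $J_1\star_I J_2$ is the unique subset $K\subset I$ with $(w_0^{J_1}w_0^I)\ast(w_0^{J_2}w_0^I)=w_0^{K}w_0^I$ (such a $K$ always exists). Connected means connected in the Coxeter graph. Type $E_7$: Bourbaki labeling, simple edges $1-3-4-5-6-7$ and $2-4$. *)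

theory Defs
  imports
    "HOL-Algebra.Generated_Groups"
    "HOL-Algebra.QuotRing"
    "HOL-Library.Poly_Mapping"
begin

definition word_prod :: "('a, 'b) monoid_scheme \<Rightarrow> ('i \<Rightarrow> 'a) \<Rightarrow> 'i list \<Rightarrow> 'a" where
  "word_prod G f u = foldr (\<lambda>i x. f i \<otimes>\<^bsub>G\<^esub> x) u \<one>\<^bsub>G\<^esub>"


section \<open>Coxeter systems\<close>

text \<open>
  A Coxeter matrix is a function \<open>m\<close> on pairs of indices. An entry \<open>m i j = 0\<close> encodes
  infinite order: the corresponding relation in the presentation is then trivial.

  \<open>coxeter_equiv I m\<close> is the congruence on words over \<open>I\<close> generated by
  \<open>(s\<^sub>i s\<^sub>j)^(m i j) = 1\<close> for all \<open>i, j \<in> I\<close>. Since \<open>m i i = 1\<close>, the case \<open>i = j\<close> says that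
  \<open>s\<^sub>i\<close> is an involution. So formal inverses of the generators are not needed, and the
  quotient of the words by this congruence is the Coxeter group itself.
\<close>

inductive coxeter_equiv :: "'i set \<Rightarrow> ('i \<Rightarrow> 'i \<Rightarrow> nat) \<Rightarrow> 'i list \<Rightarrow> 'i list \<Rightarrow> bool"
  for I m where
  relation: "\<lbrakk>i \<in> I; j \<in> I; u \<in> lists I; v \<in> lists I\<rbrakk> \<Longrightarrow>
    coxeter_equiv I m (u @ concat (replicate (m i j) [i, j]) @ v) (u @ v)"
| refl: "u \<in> lists I \<Longrightarrow> coxeter_equiv I m u u"
| sym: "coxeter_equiv I m u v \<Longrightarrow> coxeter_equiv I m v u"
| trans: "\<lbrakk>coxeter_equiv I m u v; coxeter_equiv I m v w\<rbrakk> \<Longrightarrow> coxeter_equiv I m u w"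

locale finite_coxeter_system = group W for W :: "('w, 'b) monoid_scheme" (structure) +
  fixes I :: "'i set" and s :: "'i \<Rightarrow> 'w" and m :: "'i \<Rightarrow> 'i \<Rightarrow> nat"
  assumes matrix_diag: "i \<in> I \<Longrightarrow> m i i = 1"
    and matrix_sym: "\<lbrakk>i \<in> I; j \<in> I\<rbrakk> \<Longrightarrow> m i j = m j i"
    and matrix_off_diag: "\<lbrakk>i \<in> I; j \<in> I; i \<noteq> j\<rbrakk> \<Longrightarrow> m i j \<noteq> 1"
    and simple_closed: "i \<in> I \<Longrightarrow> s i \<in> carrier W"
    and generated: "carrier W = generate W (s ` I)"
    and presentation: "\<lbrakk>u \<in> lists I; v \<in> lists I\<rbrakk> \<Longrightarrow>
      word_prod W s u = word_prod W s v \<longleftrightarrow> coxeter_equiv I m u v"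
    and finite_group: "finite (carrier W)"

definition coxeter_edges :: "('i \<Rightarrow> 'i \<Rightarrow> nat) \<Rightarrow> ('i \<times> 'i) set" where
  "coxeter_edges m = {(i, j). i \<noteq> j \<and> m i j \<noteq> 2}"

text \<open>Connectedness of the induced subgraph; the empty set counts as connected.\<close>

definition coxeter_connected :: "('i \<Rightarrow> 'i \<Rightarrow> nat) \<Rightarrow> 'i set \<Rightarrow> bool" where
  "coxeter_connected m J \<longleftrightarrow> (\<forall>i\<in>J. \<forall>j\<in>J. (i, j) \<in> (coxeter_edges m \<inter> J \<times> J)\<^sup>*)"

definition cox_length :: "('w, 'b) monoid_scheme \<Rightarrow> 'i set \<Rightarrow> ('i \<Rightarrow> 'w) \<Rightarrow> 'w \<Rightarrow> nat" where
  "cox_length W I s w = (LEAST n. \<exists>u\<in>lists I. length u = n \<and> word_prod W s u = w)"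

definition reduced_expression ::
  "('w, 'b) monoid_scheme \<Rightarrow> 'i set \<Rightarrow> ('i \<Rightarrow> 'w) \<Rightarrow> 'w \<Rightarrow> 'i list \<Rightarrow> bool" where
  "reduced_expression W I s w u \<longleftrightarrow>
     u \<in> lists I \<and> word_prod W s u = w \<and> length u = cox_length W I s w"

definition longest_element ::
  "('w, 'b) monoid_scheme \<Rightarrow> 'i set \<Rightarrow> ('i \<Rightarrow> 'w) \<Rightarrow> 'i set \<Rightarrow> 'w" where
  "longest_element W I s J =
     (THE w. w \<in> generate W (s ` J) \<and>
        (\<forall>v\<in>generate W (s ` J). cox_length W I s v \<le> cox_length W I s w))"


section \<open>The 0-Hecke algebra\<close>

text \<open>
  Words are wrapped in a type of their own, with concatenation as addition, so that
  \<open>'i free_word \<Rightarrow>\<^sub>0 int\<close> is the free associative unital ring on \<open>'i\<close>.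
\<close>

datatype 'i free_word = Word (letters: "'i list")

instantiation free_word :: (type) monoid_add
begin

definition zero_free_word :: "'a free_word" where
  "0 = Word []"

definition plus_free_word :: "'a free_word \<Rightarrow> 'a free_word \<Rightarrow> 'a free_word" where
  "x + y = Word (letters x @ letters y)"

instance
  by standard (simp_all add: zero_free_word_def plus_free_word_def)

end

abbreviation word_monom :: "'i list \<Rightarrow> ('i free_word \<Rightarrow>\<^sub>0 int)" where
  "word_monom u \<equiv> Poly_Mapping.single (Word u) 1"

definition free_algebra :: "'i set \<Rightarrow> ('i free_word \<Rightarrow>\<^sub>0 int) ring" where
  "free_algebra I = \<lparr>carrier = {p. \<forall>w \<in> Poly_Mapping.keys p. letters w \<in> lists I},
     mult = (*), one = 1, zero = 0, add = (+)\<rparr>"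

definition alternating :: "'i \<Rightarrow> 'i \<Rightarrow> nat \<Rightarrow> 'i list" where
  "alternating i j n = map (\<lambda>k. if even k then i else j) [0..<n]"

definition hecke0_relators :: "'i set \<Rightarrow> ('i \<Rightarrow> 'i \<Rightarrow> nat) \<Rightarrow> ('i free_word \<Rightarrow>\<^sub>0 int) set" where
  "hecke0_relators I m =
     {word_monom [i, i] - word_monom [i] | i. i \<in> I} \<union>
     {word_monom (alternating i j (m i j)) - word_monom (alternating j i (m i j))
        | i j. i \<in> I \<and> j \<in> I \<and> i \<noteq> j}"

definition hecke0_ideal :: "'i set \<Rightarrow> ('i \<Rightarrow> 'i \<Rightarrow> nat) \<Rightarrow> ('i free_word \<Rightarrow>\<^sub>0 int) set" where
  "hecke0_ideal I m = genideal (free_algebra I) (hecke0_relators I m)"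

definition hecke0 :: "'i set \<Rightarrow> ('i \<Rightarrow> 'i \<Rightarrow> nat) \<Rightarrow> ('i free_word \<Rightarrow>\<^sub>0 int) set ring" where
  "hecke0 I m = free_algebra I Quot hecke0_ideal I m"

definition hecke0_gen ::
  "'i set \<Rightarrow> ('i \<Rightarrow> 'i \<Rightarrow> nat) \<Rightarrow> 'i \<Rightarrow> ('i free_word \<Rightarrow>\<^sub>0 int) set" where
  "hecke0_gen I m i = hecke0_ideal I m +>\<^bsub>free_algebra I\<^esub> word_monom [i]"

text \<open>
  The element \<open>T'\<^sub>w\<close>. It does not depend on the chosen reduced expression, because any two
  reduced expressions of \<open>w\<close> are related by braid moves.
\<close>

definition hecke0_T ::
  "('w, 'b) monoid_scheme \<Rightarrow> 'i set \<Rightarrow> ('i \<Rightarrow> 'w) \<Rightarrow> ('i \<Rightarrow> 'i \<Rightarrow> nat) \<Rightarrow>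
     'w \<Rightarrow> ('i free_word \<Rightarrow>\<^sub>0 int) set" where
  "hecke0_T W I s m w =
     word_prod (hecke0 I m) (hecke0_gen I m) (SOME u. reduced_expression W I s w u)"

definition hecke_star ::
  "('w, 'b) monoid_scheme \<Rightarrow> 'i set \<Rightarrow> ('i \<Rightarrow> 'w) \<Rightarrow> ('i \<Rightarrow> 'i \<Rightarrow> nat) \<Rightarrow> 'w \<Rightarrow> 'w \<Rightarrow> 'w" where
  "hecke_star W I s m x y =
     (THE z. z \<in> carrier W \<and>
        hecke0_T W I s m x \<otimes>\<^bsub>hecke0 I m\<^esub> hecke0_T W I s m y = hecke0_T W I s m z)"

definition subset_star ::
  "('w, 'b) monoid_scheme \<Rightarrow> 'i set \<Rightarrow> ('i \<Rightarrow> 'w) \<Rightarrow> ('i \<Rightarrow> 'i \<Rightarrow> nat) \<Rightarrow>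
     'i set \<Rightarrow> 'i set \<Rightarrow> 'i set" where
  "subset_star W I s m J1 J2 =
     (let w0 = longest_element W I s in
      THE K. K \<subseteq> I \<and>
        hecke_star W I s m (w0 J1 \<otimes>\<^bsub>W\<^esub> w0 I) (w0 J2 \<otimes>\<^bsub>W\<^esub> w0 I) = w0 K \<otimes>\<^bsub>W\<^esub> w0 I)"


section \<open>Type $E_7$\<close>

definition E7_nodes :: "nat set" where
  "E7_nodes = {1..7}"

definition E7_edges :: "(nat \<times> nat) set" where
  "E7_edges = {(1, 3), (3, 4), (4, 5), (5, 6), (6, 7), (2, 4)}"

definition E7_matrix :: "nat \<Rightarrow> nat \<Rightarrow> nat" where
  "E7_matrix i j =
     (if i = j then 1 else if (i, j) \<in> E7_edges \<or> (j, i) \<in> E7_edges then 3 else 2)"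

end

theory Submission
  imports Defs
begin

text \<open>
  The star operation is computed with integer vectors. Let \<open>W\<close> act on weights, written in
  fundamental weight coordinates, and let \<open>rho\<close> be the weight with all coordinates one. The
  coordinate \<open>i\<close> of \<open>w rho\<close> is positive if \<open>s\<^sub>i w\<close> is longer than \<open>w\<close> and negative otherwise
  (\<open>vec_pos\<close>, \<open>vec_neg\<close>), and \<open>w\<close> is determined by \<open>w rho\<close> (\<open>vec_inject\<close>). Since left
  multiplication by \<open>T'\<^sub>i\<close> sends \<open>T'\<^sub>w\<close> to the basis element of the longer one of \<open>w\<close>
  and \<open>s\<^sub>i w\<close>, products in the 0-Hecke algebra become a game on vectors: reflect in \<open>i\<close> when
  coordinate \<open>i\<close> is positive, and do nothing otherwise (\<open>T_word_mult_T\<close>).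

  Two facts justify this. First, \<open>T'\<^sub>w\<close> does not depend on the chosen reduced word. This is
  Matsumoto's theorem (\<open>matsumoto\<close>), which follows from the sign rule for descents. Second,
  different \<open>w\<close> have different \<open>T'\<^sub>w\<close> (\<open>T_inject\<close>). For this, the algebra is represented on
  sets of group elements, with \<open>T'\<^sub>i\<close> multiplying by \<open>{1, s\<^sub>i}\<close>. A word then yields the set of
  products of its subwords, in which the element of a reduced word is the unique longest one.

  The longest element of \<open>W\<^sub>J\<close> is characterized by having all of \<open>J\<close> as left descents
  (\<open>longest_element_char\<close>), so its vector is found by playing the game with the letters in
  \<open>J\<close>. In type $E_7$ the longest element of \<open>W\<close> acts as minus one, so the vector of
  \<open>w\<^sub>0\<^sup>J w\<^sub>0\<^sup>I\<close> is the negative of the one of \<open>w\<^sub>0\<^sup>J\<close>. For \<open>J \<subseteq> K\<close> the element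
  \<open>w\<^sub>0\<^sup>J w\<^sub>0\<^sup>I\<close> is a length additive multiple of \<open>w\<^sub>0\<^sup>K w\<^sub>0\<^sup>I\<close>, so a product that is already the
  longest element stays so when the subsets shrink (\<open>subset_star_empty_mono\<close>). This reduces
  the theorem to 26 products of explicit vectors.
\<close>

section \<open>Words, lengths and the action on weights\<close>

text \<open>
  The action of \<open>s\<^sub>i\<close> on the weight with coordinates \<open>v\<close> in the basis of fundamental weights.
  This is dual to the usual reflection representation on roots. It is the more convenient of
  the two because it needs no sum over the index set.
\<close>

definition reflect :: "('i \<Rightarrow> 'i \<Rightarrow> nat) \<Rightarrow> 'i \<Rightarrow> ('i \<Rightarrow> int) \<Rightarrow> 'i \<Rightarrow> int" where
  "reflect m i v = (\<lambda>k. if k = i then - v i else if m i k = 3 then v k + v i else v k)"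

lemma reflect_reflect: "reflect m i (reflect m i v) = v"
  by (rule ext) (simp add: reflect_def)

(* Otherwise auto unfolds membership in lists I to a statement about all letters. *)
declare in_listsD [rule del] in_listsI [rule del]

lemma rev_in_lists [simp]: "rev u \<in> lists A \<longleftrightarrow> u \<in> lists A"
  by (simp add: in_lists_conv_set)

lemma alternating_2: "alternating i j 2 = [i, j]"
  by (simp add: alternating_def numeral_2_eq_2)

lemma alternating_3: "alternating i j 3 = [i, j, i]"
  by (simp add: alternating_def numeral_3_eq_3)

lemma length_coxeter_relator: "length (concat (replicate n [i, j])) = 2 * n"
  by (induction n) auto

text \<open>
  Simply laced systems suffice for type $E_7$, and they make the rank two arguments short: two
  simple reflections generate a group of order four or six, so each such argument is
  a computation with at most three letters.
\<close>

locale simply_laced_coxeter_system = finite_coxeter_system W I s m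
  for W :: "('w, 'b) monoid_scheme" (structure) and I :: "'i set" and s m +
  assumes simply_laced: "\<lbrakk>i \<in> I; j \<in> I; i \<noteq> j\<rbrakk> \<Longrightarrow> m i j = 2 \<or> m i j = 3"
begin

abbreviation wp :: "'i list \<Rightarrow> 'w" where "wp \<equiv> word_prod W s"
abbreviation len :: "'w \<Rightarrow> nat" where "len \<equiv> cox_length W I s"

lemma wp_Nil [simp]: "wp [] = \<one>" and wp_Cons [simp]: "wp (i # u) = s i \<otimes> wp u"
  by (simp_all add: word_prod_def)

lemma wp_closed [simp]: "u \<in> lists I \<Longrightarrow> wp u \<in> carrier W"
  by (induction u) (auto simp: simple_closed)

lemma wp_append: "\<lbrakk>u \<in> lists I; v \<in> lists I\<rbrakk> \<Longrightarrow> wp (u @ v) = wp u \<otimes> wp v"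
  by (induction u) (auto simp: simple_closed m_assoc)

lemma simple_square: assumes "i \<in> I" shows "s i \<otimes> s i = \<one>"
proof -
  have "coxeter_equiv I m [i, i] []"
    using coxeter_equiv.relation[of i I i "[]" "[]" m] assms matrix_diag[of i] by simp
  then show ?thesis
    using presentation[of "[i, i]" "[]"] assms by (simp add: simple_closed)
qed

lemma simple_cancel [simp]:
  assumes "i \<in> I" "x \<in> carrier W" shows "s i \<otimes> (s i \<otimes> x) = x"
  by (metis assms l_one m_assoc simple_closed simple_square)

lemma wp_rev: "u \<in> lists I \<Longrightarrow> wp (rev u) = inv (wp u)"
proof (induction u)
  case (Cons i u)
  then have "wp (rev (i # u)) = inv (wp u) \<otimes> s i"
    by (simp add: wp_append simple_closed)
  also have "s i = inv (s i)"
    using Cons.prems by (metis inv_equality simple_closed simple_square Cons_in_lists_iff)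
  finally show ?case using Cons.prems by (simp add: inv_mult_group simple_closed)
qed simp

lemma wp_alternating:
  assumes "i \<in> I" "j \<in> I" "i \<noteq> j"
  shows "wp (alternating i j (m i j)) = wp (alternating j i (m i j))"
proof -
  have ij: "s i \<in> carrier W" "s j \<in> carrier W" using assms simple_closed by auto
  have "coxeter_equiv I m (concat (replicate (m i j) [i, j])) []"
    using coxeter_equiv.relation[of i I j "[]" "[]" m] assms by simp
  then have rel: "wp (concat (replicate (m i j) [i, j])) = \<one>"
    using presentation[of "concat (replicate (m i j) [i, j])" "[]"] assms by (auto simp: in_lists_conv_set)
  consider "m i j = 2" | "m i j = 3" using simply_laced assms by blast
  then show ?thesis
  proof cases
    case 1
    then have "wp [i, j] \<otimes> wp [i, j] = \<one>"
      using rel ij by (simp add: numeral_2_eq_2 m_assoc)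
    then have "inv (wp [i, j]) = wp [i, j]" using assms by (intro inv_equality) (auto simp: simple_closed)
    then show ?thesis using 1 wp_rev[of "[i, j]"] assms
      by (simp add: alternating_2)
  next
    case 2
    then have "wp [i, j, i] \<otimes> wp [j, i, j] = \<one>"
      using rel ij by (simp add: numeral_3_eq_3 m_assoc)
    then have "inv (wp [j, i, j]) = wp [i, j, i]" using assms by (intro inv_equality) (auto simp: simple_closed)
    then show ?thesis using 2 wp_rev[of "[j, i, j]"] assms
      by (simp add: alternating_3)
  qed
qed

lemma simple_commute:
  assumes "i \<in> I" "j \<in> I" "i \<noteq> j" "m i j = 2" "x \<in> carrier W"
  shows "s i \<otimes> (s j \<otimes> x) = s j \<otimes> (s i \<otimes> x)"
proof -
  have "s i \<otimes> s j = s j \<otimes> s i"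
    using wp_alternating[OF assms(1-3)] assms by (simp add: alternating_2 simple_closed)
  then show ?thesis using assms by (metis m_assoc simple_closed)
qed

lemma simple_braid:
  assumes "i \<in> I" "j \<in> I" "i \<noteq> j" "m i j = 3" "x \<in> carrier W"
  shows "s i \<otimes> (s j \<otimes> (s i \<otimes> x)) = s j \<otimes> (s i \<otimes> (s j \<otimes> x))"
proof -
  have "s i \<otimes> (s j \<otimes> s i) = s j \<otimes> (s i \<otimes> s j)"
    using wp_alternating[OF assms(1-3)] assms by (simp add: alternating_3 simple_closed)
  then have "(s i \<otimes> (s j \<otimes> s i)) \<otimes> x = (s j \<otimes> (s i \<otimes> s j)) \<otimes> x" by simp
  then show ?thesis using assms by (simp add: m_assoc simple_closed)
qed

lemma generate_eq_words:
  assumes "J \<subseteq> I" shows "generate W (s ` J) = wp ` lists J"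
proof (intro equalityI subsetI)
  fix x assume "x \<in> generate W (s ` J)"
  then show "x \<in> wp ` lists J"
  proof (induction rule: generate.induct)
    case one then show ?case by (metis wp_Nil image_eqI lists.Nil)
  next
    case (incl h)
    then obtain j where "j \<in> J" "h = s j" by auto
    then have "h = wp [j]" "[j] \<in> lists J" using assms simple_closed by auto
    then show ?case by blast
  next
    case (inv h)
    then obtain j where "j \<in> J" "h = s j" by auto
    then have "inv h = wp [j]" "[j] \<in> lists J"
      using assms simple_closed simple_square[of j] by (auto intro!: inv_equality)
    then show ?case by blast
  next
    case (eng h1 h2)
    then obtain u v where "u \<in> lists J" "h1 = wp u" "v \<in> lists J" "h2 = wp v" by auto
    moreover from this have "u \<in> lists I" "v \<in> lists I" using lists_mono[OF assms] by auto
    ultimately have "h1 \<otimes> h2 = wp (u @ v)" "u @ v \<in> lists J" by (simp_all add: wp_append)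
    then show ?case by (rule image_eqI)
  qed
next
  fix x assume "x \<in> wp ` lists J"
  then obtain u where "u \<in> lists J" "x = wp u" by auto
  moreover have "u \<in> lists J \<Longrightarrow> wp u \<in> generate W (s ` J)" for u
    by (induction u) (auto intro: generate.intros)
  ultimately show "x \<in> generate W (s ` J)" by blast
qed

lemma element_word: assumes "w \<in> carrier W" obtains u where "u \<in> lists I" "wp u = w"
proof -
  have "w \<in> wp ` lists I" using assms generated generate_eq_words[of I] by simp
  then show ?thesis using that by auto
qed

lemma ex_reduced: assumes "w \<in> carrier W" obtains u where "reduced_expression W I s w u"
proof -
  obtain v where "v \<in> lists I" "wp v = w" using element_word[OF assms] .
  then have "\<exists>n. \<exists>u\<in>lists I. length u = n \<and> wp u = w" by blast
  from LeastI_ex[OF this] show ?thesis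
    using that unfolding reduced_expression_def cox_length_def by blast
qed

lemma len_wp_le: "u \<in> lists I \<Longrightarrow> len (wp u) \<le> length u"
  unfolding cox_length_def by (rule Least_le) blast

lemma even_length_coxeter_equiv:
  "coxeter_equiv I m u v \<Longrightarrow> even (length u) = even (length v)"
  by (induction rule: coxeter_equiv.induct) (simp_all add: length_coxeter_relator)

lemma even_len_wp: assumes "u \<in> lists I" shows "even (len (wp u)) = even (length u)"
proof -
  obtain v where v: "reduced_expression W I s (wp u) v" using ex_reduced[OF wp_closed[OF assms]] .
  then have "coxeter_equiv I m v u"
    using presentation[of v u] assms unfolding reduced_expression_def by simp
  then show ?thesis using v even_length_coxeter_equiv unfolding reduced_expression_def by metis
qed

lemma len_simple_le: assumes "i \<in> I" "w \<in> carrier W" shows "len (s i \<otimes> w) \<le> Suc (len w)"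
proof -
  obtain u where u: "reduced_expression W I s w u" using ex_reduced[OF assms(2)] .
  then show ?thesis using len_wp_le[of "i # u"] assms by (auto simp: reduced_expression_def)
qed

lemma len_le_simple: assumes "i \<in> I" "w \<in> carrier W" shows "len w \<le> Suc (len (s i \<otimes> w))"
  using len_simple_le[of i "s i \<otimes> w"] assms by (simp add: simple_closed)

lemma len_simple_cases:
  assumes "i \<in> I" "w \<in> carrier W"
  shows "len (s i \<otimes> w) = Suc (len w) \<or> len w = Suc (len (s i \<otimes> w))"
proof -
  obtain u where "u \<in> lists I" "wp u = w" using element_word[OF assms(2)] .
  then have "even (len (s i \<otimes> w)) \<noteq> even (len w)"
    using even_len_wp[of u] even_len_wp[of "i # u"] assms by auto
  moreover have "len w \<noteq> len (s i \<otimes> w)" using calculation by auto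
  ultimately show ?thesis using len_simple_le[OF assms] len_le_simple[OF assms] by linarith
qed

lemma len_one [simp]: "len \<one> = 0" using len_wp_le[of "[]"] by simp

lemma left_factor:
  assumes "w \<in> carrier W" "w \<noteq> \<one>"
  obtains j w' where "j \<in> I" "w' \<in> carrier W" "w = s j \<otimes> w'" "len w = Suc (len w')"
proof -
  obtain u where u: "reduced_expression W I s w u" using ex_reduced[OF assms(1)] .
  then obtain j v where v: "u = j # v" using assms(2)
    by (cases u) (auto simp: reduced_expression_def)
  have *: "j \<in> I" "v \<in> lists I" "w = s j \<otimes> wp v" "len w = Suc (length v)"
    using u v by (auto simp: reduced_expression_def)
  moreover have "len w = Suc (len (wp v))"
    using len_wp_le[of v] len_simple_le[of j "wp v"] * by auto
  ultimately show ?thesis using that[of j "wp v"] by simp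
qed

lemma reflect_commute:
  assumes "i \<in> I" "j \<in> I" "i \<noteq> j" "m i j = 2"
  shows "reflect m i (reflect m j v) = reflect m j (reflect m i v)"
  using assms matrix_sym[of i j] by (intro ext) (simp add: reflect_def)

lemma reflect_braid:
  assumes "i \<in> I" "j \<in> I" "i \<noteq> j" "m i j = 3"
  shows "reflect m i (reflect m j (reflect m i v)) = reflect m j (reflect m i (reflect m j v))"
  using assms matrix_sym[of i j] by (intro ext) (simp add: reflect_def)

lemma reflect_coxeter_equiv:
  "coxeter_equiv I m u w \<Longrightarrow> foldr (reflect m) u v = foldr (reflect m) w v"
proof (induction arbitrary: v rule: coxeter_equiv.induct)
  case (relation i j u w)
  have "foldr (reflect m) (concat (replicate (m i j) [i, j])) v = v" for v
  proof (cases "i = j")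
    case True
    then show ?thesis using relation by (simp add: matrix_diag reflect_reflect)
  next
    case False
    then consider "m i j = 2" | "m i j = 3" using simply_laced relation by blast
    then show ?thesis
    proof cases
      case 1
      then show ?thesis using reflect_commute[of i j] relation False
        by (simp add: numeral_2_eq_2 reflect_reflect)
    next
      case 2
      then show ?thesis using reflect_braid[of i j] relation False
        by (simp add: numeral_3_eq_3 reflect_reflect)
    qed
  qed
  then show ?case by simp
qed auto

text \<open>
  Group elements are represented by the images of the strictly dominant weight \<open>rho\<close>. The
  choice of a word in \<open>vec\<close> does not matter by the presentation of the group.
\<close>

abbreviation rho :: "'i \<Rightarrow> int" where "rho \<equiv> \<lambda>k. of_bool (k \<in> I)"

definition vec :: "'w \<Rightarrow> 'i \<Rightarrow> int" where
  "vec w = foldr (reflect m) (SOME u. u \<in> lists I \<and> wp u = w) rho"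

lemma vec_wp: assumes "u \<in> lists I" shows "vec (wp u) = foldr (reflect m) u rho"
proof -
  let ?v = "SOME v. v \<in> lists I \<and> wp v = wp u"
  have "?v \<in> lists I \<and> wp ?v = wp u" using assms by - (rule someI_ex, blast)
  then have "coxeter_equiv I m ?v u" using presentation[of ?v u] assms by simp
  then show ?thesis unfolding vec_def by (rule reflect_coxeter_equiv)
qed

lemma vec_one [simp]: "vec \<one> = rho" using vec_wp[of "[]"] by simp

lemma vec_mult:
  assumes "u \<in> lists I" "w \<in> carrier W"
  shows "vec (wp u \<otimes> w) = foldr (reflect m) u (vec w)"
proof -
  obtain v where "v \<in> lists I" "wp v = w" using element_word[OF assms(2)] .
  then show ?thesis using assms vec_wp[of "u @ v"] vec_wp[of v] by (auto simp: wp_append)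
qed

lemma vec_simple: "\<lbrakk>i \<in> I; w \<in> carrier W\<rbrakk> \<Longrightarrow> vec (s i \<otimes> w) = reflect m i (vec w)"
  using vec_mult[of "[i]" w] by (simp add: simple_closed)

text \<open>
  The key fact: the length function is visible on the orbit of \<open>rho\<close>. The induction writes
  \<open>w = s\<^sub>j w'\<close> with \<open>w'\<close> shorter, and splits off from \<open>w\<close> as much of the group generated by
  \<open>s\<^sub>i\<close> and \<open>s\<^sub>j\<close> as the lengths permit. What remains is shorter and is lengthened by both,
  so the induction hypothesis gives the sign of both coordinates.
\<close>

lemma vec_pos:
  assumes "w \<in> carrier W" "i \<in> I" "len w < len (s i \<otimes> w)"
  shows "0 < vec w i"
  using assms
proof (induction "len w" arbitrary: w i rule: less_induct)
  case less
  note si = simple_closed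
  show ?case
  proof (cases "w = \<one>")
    case False
    then obtain j w' where w': "j \<in> I" "w' \<in> carrier W" "w = s j \<otimes> w'" "len w = Suc (len w')"
      using left_factor less.prems(1) by blast
    have ij: "i \<noteq> j" using w' less.prems by auto
    have up: "0 < vec y k" if "y \<in> carrier W" "k \<in> I" "len y \<le> len w'" "len y < len (s k \<otimes> y)" for y k
      using less.hyps[of y k] that w'(4) by auto
    have posj: "0 < vec w' j" using up[of w' j] w' by simp
    consider "m i j = 2" | "m i j = 3" using simply_laced ij less.prems w' by blast
    then show ?thesis
    proof cases
      case 1
      have "len w' < len (s i \<otimes> w')"
      proof (rule ccontr)
        assume "\<not> ?thesis"
        then have "len w' = Suc (len (s i \<otimes> w'))" using len_simple_cases less.prems(2) w'(2) by fastforce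
        moreover have "s i \<otimes> w = s j \<otimes> (s i \<otimes> w')"
          using simple_commute[of i j w'] 1 ij less.prems w' by simp
        ultimately show False
          using len_simple_le[of j "s i \<otimes> w'"] less.prems w' si by simp
      qed
      then have "0 < vec w' i" using up[of w' i] less.prems w' by simp
      then show ?thesis using w' ij 1 less.prems matrix_sym[of i j] by (simp add: vec_simple reflect_def)
    next
      case 2
      have vi: "vec w i = vec w' i + vec w' j"
        using w' ij 2 less.prems matrix_sym[of i j] by (simp add: vec_simple reflect_def)
      show ?thesis
      proof (cases "len w' < len (s i \<otimes> w')")
        case True
        then show ?thesis using vi posj up[of w' i] less.prems w' by simp
      next
        case False
        define x where "x = s i \<otimes> w'"
        have x: "x \<in> carrier W" "w' = s i \<otimes> x" "len w' = Suc (len x)"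
          using len_simple_cases[of i w'] less.prems(2) w'(2) False by (auto simp: x_def si)
        have "len x < len (s j \<otimes> x)"
        proof (rule ccontr)
          assume "\<not> ?thesis"
          then have y: "len x = Suc (len (s j \<otimes> x))" using len_simple_cases w'(1) x(1) by fastforce
          have "s i \<otimes> w = s i \<otimes> (s j \<otimes> (s i \<otimes> (s j \<otimes> (s j \<otimes> x))))" using w' x by simp
          also have "\<dots> = s j \<otimes> (s i \<otimes> (s j \<otimes> (s j \<otimes> (s j \<otimes> x))))"
            using simple_braid[of i j "s j \<otimes> (s j \<otimes> x)"] 2 ij less.prems w' x(1) si by simp
          also have "\<dots> = s j \<otimes> (s i \<otimes> (s j \<otimes> x))" using w' x si by simp
          finally have "len (s i \<otimes> w) \<le> Suc (Suc (len (s j \<otimes> x)))"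
            using len_simple_le[of j "s i \<otimes> (s j \<otimes> x)"] len_simple_le[of i "s j \<otimes> x"] less.prems w' x si
            by simp
          then show False using y x w' less.prems by simp
        qed
        then have "0 < vec x j" using up[of x j] x w' by simp
        then show ?thesis using vi x ij 2 less.prems w' matrix_sym[of i j]
          by (simp add: vec_simple reflect_def)
      qed
    qed
  qed (use less.prems in simp)
qed

lemma vec_neg:
  assumes "w \<in> carrier W" "i \<in> I" "len (s i \<otimes> w) < len w"
  shows "vec w i < 0"
proof -
  have "0 < vec (s i \<otimes> w) i" using vec_pos[of "s i \<otimes> w" i] assms by (simp add: simple_closed)
  then show ?thesis using assms by (simp add: vec_simple reflect_def)
qed

lemma ascent_iff: "\<lbrakk>w \<in> carrier W; i \<in> I\<rbrakk> \<Longrightarrow> 0 < vec w i \<longleftrightarrow> len (s i \<otimes> w) = Suc (len w)"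
  using len_simple_cases[of i w] vec_pos[of w i] vec_neg[of w i] by fastforce

lemma descent_iff: "\<lbrakk>w \<in> carrier W; i \<in> I\<rbrakk> \<Longrightarrow> vec w i < 0 \<longleftrightarrow> len w = Suc (len (s i \<otimes> w))"
  using len_simple_cases[of i w] vec_pos[of w i] vec_neg[of w i] by fastforce

lemma foldr_reflect_rev: "foldr (reflect m) (rev u) (foldr (reflect m) u v) = v"
  by (induction u arbitrary: v) (auto simp: reflect_reflect)

text \<open>
  If \<open>x\<close> and \<open>y\<close> have the same vector, then \<open>x\<^sup>-\<^sup>1 y\<close> fixes \<open>rho\<close>, so no simple reflection
  shortens it, and only the identity has this property. Hence equality in the
  group is decided by comparing vectors.
\<close>

lemma vec_inject:
  assumes "x \<in> carrier W" "y \<in> carrier W" "vec x = vec y"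
  shows "x = y"
proof -
  obtain u where u: "u \<in> lists I" "wp u = x" using element_word[OF assms(1)] .
  define z where "z = inv x \<otimes> y"
  have ru: "rev u \<in> lists I" using u by auto
  have z: "z = wp (rev u) \<otimes> y" using u wp_rev by (simp add: z_def)
  have zc: "z \<in> carrier W" using assms z_def by simp
  have "vec z = foldr (reflect m) (rev u) (vec x)"
    using vec_mult[OF ru assms(2)] z assms(3) by simp
  also have "\<dots> = rho" using vec_wp[of u] u by (metis foldr_reflect_rev)
  finally have zr: "vec z = rho" .
  have asc: "len (s i \<otimes> z) = Suc (len z)" if "i \<in> I" for i
    using ascent_iff[OF zc that] zr that by simp
  have "z = \<one>"
  proof (rule ccontr)
    assume "z \<noteq> \<one>"
    then obtain j w' where "j \<in> I" "w' \<in> carrier W" "z = s j \<otimes> w'" "len z = Suc (len w')"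
      using left_factor zc by blast
    then show False using asc[of j] by simp
  qed
  then show ?thesis using assms z_def by (metis inv_equality inv_inv inv_closed)
qed

end

section \<open>Reduced words and braid moves\<close>

inductive braid_equiv :: "'i set \<Rightarrow> ('i \<Rightarrow> 'i \<Rightarrow> nat) \<Rightarrow> 'i list \<Rightarrow> 'i list \<Rightarrow> bool"
  for I m where
  braid: "\<lbrakk>i \<in> I; j \<in> I; i \<noteq> j; u \<in> lists I; v \<in> lists I\<rbrakk> \<Longrightarrow>
    braid_equiv I m (u @ alternating i j (m i j) @ v) (u @ alternating j i (m i j) @ v)"
| braid_refl: "u \<in> lists I \<Longrightarrow> braid_equiv I m u u"
| braid_sym: "braid_equiv I m u v \<Longrightarrow> braid_equiv I m v u"
| braid_trans: "\<lbrakk>braid_equiv I m u v; braid_equiv I m v w\<rbrakk> \<Longrightarrow> braid_equiv I m u w"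

lemma braid_equiv_Cons:
  "braid_equiv I m u v \<Longrightarrow> i \<in> I \<Longrightarrow> braid_equiv I m (i # u) (i # v)"
proof (induction rule: braid_equiv.induct)
  case (braid j k u v)
  then show ?case using braid_equiv.braid[of j I k "i # u" v m] by simp
qed (auto intro: braid_equiv.intros)

context simply_laced_coxeter_system begin

abbreviation red :: "'w \<Rightarrow> 'i list \<Rightarrow> bool" where "red \<equiv> reduced_expression W I s"

lemma set_braid_equiv: "braid_equiv I m u v \<Longrightarrow> set u = set v"
proof (induction rule: braid_equiv.induct)
  case (braid i j u v)
  then show ?case using simply_laced[of i j]
    by (auto simp: alternating_2 alternating_3)
qed auto

lemma red_D: assumes "red w u" shows "u \<in> lists I" "wp u = w" "length u = len w" "w \<in> carrier W"
  using assms by (auto simp: reduced_expression_def)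

lemma red_Cons: 
  assumes "red w u" "i \<in> I" "len (s i \<otimes> w) = Suc (len w)" shows "red (s i \<otimes> w) (i # u)"
  using assms by (simp add: reduced_expression_def)

lemma red_ConsD:
  assumes "red w (i # u)" shows "i \<in> I" "red (s i \<otimes> w) u" "len w = Suc (len (s i \<otimes> w))"
proof -
  have *: "i \<in> I" "u \<in> lists I" "w = s i \<otimes> wp u" "len w = Suc (length u)"
    using assms by (auto simp: reduced_expression_def)
  show "i \<in> I" by fact
  have w: "w \<in> carrier W" "s i \<otimes> w = wp u" using * by (auto simp: simple_closed)
  have "len (wp u) = length u" using len_wp_le[of u] len_le_simple[of i w] * w by auto
  then show "red (s i \<otimes> w) u" "len w = Suc (len (s i \<otimes> w))"
    using * w by (auto simp: reduced_expression_def)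
qed

text \<open>
  Matsumoto's theorem. Let two reduced words of \<open>w\<close> begin with different letters \<open>i\<close> and \<open>j\<close>.
  Both coordinates of \<open>vec w\<close> are then negative, and following them through two or
  three reflections shows that the longest element of the group generated by \<open>s\<^sub>i\<close> and \<open>s\<^sub>j\<close>
  splits off from \<open>w\<close> on the left, with lengths adding up. Its two reduced words differ by one
  braid move, and induction connects each of them to the given words.
\<close>

theorem matsumoto: "red w u \<Longrightarrow> red w v \<Longrightarrow> braid_equiv I m u v"
proof (induction "len w" arbitrary: w u v rule: less_induct)
  case less
  note w = red_D[OF less.prems(1)] and wv = red_D[OF less.prems(2)]
  show ?case
  proof (cases "u = []")
    case True
    then show ?thesis using w wv by (auto intro: braid_refl)
  next
    case False
    then obtain i u' j v' where uv: "u = i # u'" "v = j # v'"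
      using w(3) wv(3) by (metis length_0_conv neq_Nil_conv)
    note i = red_ConsD[OF less.prems(1)[unfolded uv]]
    note j = red_ConsD[OF less.prems(2)[unfolded uv]]
    have IH: "braid_equiv I m (k # x) (k # y)"
      if "k \<in> I" "red (s k \<otimes> w) x" "red (s k \<otimes> w) y" "len w = Suc (len (s k \<otimes> w))" for k x y
      using less.hyps[of "s k \<otimes> w" x y] that by (auto intro: braid_equiv_Cons)
    show ?thesis
    proof (cases "i = j")
      case True
      then show ?thesis using IH[of i u' v'] i j uv by simp
    next
      case False
      have wc: "w \<in> carrier W" by fact
      note cl = simple_closed
      have vi: "vec w i < 0" and vj: "vec w j < 0" using descent_iff wc i j by auto
      consider "m i j = 2" | "m i j = 3" using simply_laced False i j by blast
      then show ?thesis
      proof cases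
        case 1
        define x where "x = s j \<otimes> (s i \<otimes> w)"
        have x: "x \<in> carrier W" "s i \<otimes> w = s j \<otimes> x" using i j wc cl by (auto simp: x_def)
        have "x = s i \<otimes> (s j \<otimes> w)" using i j wc simple_commute[of i j w] 1 False by (simp add: x_def)
        then have "s j \<otimes> w = s i \<otimes> x" using i j wc cl by simp
        note x = x this
        have "vec (s i \<otimes> w) j < 0"
          using vj 1 False i wc by (simp add: vec_simple reflect_def)
        then have lx: "len (s i \<otimes> w) = Suc (len x)"
          using descent_iff[of "s i \<otimes> w" j] i j wc cl by (simp add: x_def)
        obtain r where r: "red x r" using ex_reduced x by blast
        have jr: "red (s i \<otimes> w) (j # r)" and ir: "red (s j \<otimes> w) (i # r)"
          using red_Cons[OF r, of j] red_Cons[OF r, of i] x lx i j by auto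
        have "braid_equiv I m (i # j # r) (j # i # r)"
          using braid_equiv.braid[of i I j "[]" r m] 1 False i j red_D[OF r]
          by (simp add: alternating_2)
        then show ?thesis using IH[of i u' "j # r"] IH[of j "i # r" v'] i j jr ir uv
          by (blast intro: braid_trans)
      next
        case 2
        have mji: "m j i = 3" using 2 matrix_sym i j by metis
        define y where "y = s j \<otimes> (s i \<otimes> w)"
        define x where "x = s i \<otimes> y"
        have y: "y \<in> carrier W" and x: "x \<in> carrier W"
          using wc i j cl by (auto simp: x_def y_def)
        have w1: "w = s i \<otimes> (s j \<otimes> (s i \<otimes> x))" using wc i j cl by (simp add: x_def y_def)
        also have "\<dots> = s j \<otimes> (s i \<otimes> (s j \<otimes> x))" using simple_braid[of i j x] 2 False i j x by simp
        finally have w2: "w = s j \<otimes> (s i \<otimes> (s j \<otimes> x))" .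
        have wi: "s i \<otimes> w = s j \<otimes> (s i \<otimes> x)" and wj: "s j \<otimes> w = s i \<otimes> (s j \<otimes> x)"
          using arg_cong[OF w1, of "\<lambda>z. s i \<otimes> z"] arg_cong[OF w2, of "\<lambda>z. s j \<otimes> z"] i j cl x
          by simp_all
        have "vec (s i \<otimes> w) j < 0" "vec y i < 0"
          using vi vj 2 mji False i j wc cl by (simp_all add: y_def vec_simple reflect_def)
        then have lw: "len (s i \<otimes> w) = Suc (len y)" "len y = Suc (len x)"
          using descent_iff[of "s i \<otimes> w" j] descent_iff[of y i] i j wc cl y by (simp_all add: y_def x_def)
        obtain r where r: "red x r" using ex_reduced x by blast
        have rI: "r \<in> lists I" using red_D r by blast
        have lwj: "len (s j \<otimes> w) = Suc (Suc (len x))" using lw i j by simp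
        have jir: "red (s i \<otimes> w) (j # i # r)" and ijr: "red (s j \<otimes> w) (i # j # r)"
          using wi wj lw lwj red_D[OF r] i j by (auto simp: reduced_expression_def)
        have "braid_equiv I m (i # j # i # r) (j # i # j # r)"
          using braid_equiv.braid[of i I j "[]" r m] 2 False i j rI
          by (simp add: alternating_3)
        then show ?thesis using IH[of i u' "j # i # r"] IH[of j "i # j # r" v'] i j jir ijr uv
          by (blast intro: braid_trans)
      qed
    qed
  qed
qed

text \<open>
  Braid moves preserve the set of letters, so all reduced words of an element use the same ones.
\<close>

lemma red_parabolic:
  assumes "J \<subseteq> I" "w \<in> generate W (s ` J)" "red w u"
  shows "u \<in> lists J"
proof -
  have "red (wp v) u \<Longrightarrow> v \<in> lists J \<Longrightarrow> u \<in> lists J" for u v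
  proof (induction v arbitrary: u)
    case Nil
    then show ?case by (simp add: reduced_expression_def)
  next
    case (Cons i v)
    then have i: "i \<in> I" "i \<in> J" "v \<in> lists I" using assms lists_mono[OF assms(1)] by auto
    let ?x = "wp v"
    obtain r where r: "red ?x r" using ex_reduced i by (meson wp_closed)
    have rJ: "r \<in> lists J" using Cons r by simp
    show ?case
    proof (cases "len (s i \<otimes> ?x) = Suc (len ?x)")
      case True
      then have "red (wp (i # v)) (i # r)" using red_Cons[OF r] i by simp
      then have "set u = set (i # r)" using Cons.prems matsumoto set_braid_equiv by blast
      then show ?thesis using rJ i by (simp add: in_lists_conv_set)
    next
      case False
      then have "len ?x = Suc (len (s i \<otimes> ?x))" using len_simple_cases i by (meson wp_closed)
      then have "red ?x (i # u)" using Cons.prems i red_Cons[of "s i \<otimes> ?x" u i] by simp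
      then have "set (i # u) = set r" using r matsumoto set_braid_equiv by blast
      then show ?thesis using rJ by (auto simp: in_lists_conv_set)
    qed
  qed
  then show ?thesis using assms generate_eq_words by auto
qed

end

section \<open>The 0-Hecke algebra of a Coxeter matrix\<close>

lemma free_algebra_simps:
  "p \<in> carrier (free_algebra I) \<longleftrightarrow> (\<forall>w \<in> Poly_Mapping.keys p. letters w \<in> lists I)"
  "p \<otimes>\<^bsub>free_algebra I\<^esub> q = p * q" "p \<oplus>\<^bsub>free_algebra I\<^esub> q = p + q"
  "\<one>\<^bsub>free_algebra I\<^esub> = 1" "\<zero>\<^bsub>free_algebra I\<^esub> = 0"
  by (simp_all add: free_algebra_def)

lemma word_monom_closed: "word_monom u \<in> carrier (free_algebra I) \<longleftrightarrow> u \<in> lists I"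
  by (simp add: free_algebra_simps)

lemma free_algebra_diff_closed:
  "\<lbrakk>p \<in> carrier (free_algebra I); q \<in> carrier (free_algebra I)\<rbrakk>
    \<Longrightarrow> p - q \<in> carrier (free_algebra I)"
  unfolding free_algebra_simps using keys_diff[of p q] by blast

lemma word_monom_mult: "word_monom u * word_monom v = word_monom (u @ v)"
  by (simp add: mult_single plus_free_word_def)

lemma ring_free_algebra: "ring (free_algebra I)"
proof (rule ringI)
  show "abelian_group (free_algebra I)"
  proof (rule abelian_groupI, unfold free_algebra_simps(2-5))
    fix p q assume "p \<in> carrier (free_algebra I)" "q \<in> carrier (free_algebra I)"
    then show "p + q \<in> carrier (free_algebra I)"
      unfolding free_algebra_simps using Poly_Mapping.keys_add[of p q] by blast
  next
    fix p assume "p \<in> carrier (free_algebra I)"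
    then show "\<exists>q \<in> carrier (free_algebra I). q + p = 0"
      using free_algebra_diff_closed[of 0 I p] by (intro bexI[of _ "- p"]) (simp_all add: free_algebra_simps)
  qed (simp_all add: free_algebra_simps(1))
  show "monoid (free_algebra I)"
  proof (rule monoidI, unfold free_algebra_simps(2-5))
    fix p q assume "p \<in> carrier (free_algebra I)" "q \<in> carrier (free_algebra I)"
    then show "p * q \<in> carrier (free_algebra I)"
      unfolding free_algebra_simps using keys_mult[of p q] by (fastforce simp: plus_free_word_def)
  qed (simp_all add: free_algebra_simps(1) mult.assoc zero_free_word_def)
qed (simp_all add: free_algebra_simps algebra_simps)

lemma free_algebra_a_minus:
  assumes "p \<in> carrier (free_algebra I)" "q \<in> carrier (free_algebra I)"
  shows "p \<ominus>\<^bsub>free_algebra I\<^esub> q = p - q"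
proof -
  interpret ring "free_algebra I" by (rule ring_free_algebra)
  have "- q \<in> carrier (free_algebra I)"
    using free_algebra_diff_closed[of 0 I q] assms by (simp add: free_algebra_simps)
  then have "\<ominus>\<^bsub>free_algebra I\<^esub> q = - q"
    using assms by (intro minus_equality) (simp_all add: free_algebra_simps)
  then show ?thesis by (simp add: a_minus_def free_algebra_simps)
qed

text \<open>
  Letters acting as arbitrary maps \<open>f i\<close> on a set of points give a representation of the free
  algebra on formal integer combinations of maps, with composition as product. If the maps
  satisfy the defining relations of the 0-Hecke algebra, the kernel contains the
  ideal of relations. Words that act differently are thus different in the 0-Hecke algebra.
\<close>

definition operator_sum :: "('i \<Rightarrow> 'x \<Rightarrow> 'x) \<Rightarrow> ('i free_word \<Rightarrow>\<^sub>0 int) \<Rightarrow> (('x \<Rightarrow> 'x) \<Rightarrow>\<^sub>0 int)" where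
  "operator_sum f = frag_extend (\<lambda>w. frag_of (foldr f (letters w)))"

lemma operator_sum_simps [simp]:
  "operator_sum f (word_monom u) = frag_of (foldr f u)"
  "operator_sum f 0 = 0"
  "operator_sum f (p - q) = operator_sum f p - operator_sum f q"
  by (simp_all add: operator_sum_def frag_extend_diff)

lemma foldr_append_comp: "foldr f (u @ v) = foldr f u \<circ> foldr f v"
  by (rule ext) simp

lemma operator_sum_mult_left:
  "operator_sum f (word_monom u * p) = frag_extend (\<lambda>g. frag_of (foldr f u \<circ> g)) (operator_sum f p)"
proof (induction p rule: frag_induction[OF subset_UNIV])
  case (2 x)
  then show ?case by (cases x) (simp add: word_monom_mult foldr_append_comp comp_def)
qed (simp_all add: right_diff_distrib frag_extend_diff)

lemma operator_sum_mult_right: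
  "operator_sum f (p * word_monom u) = frag_extend (\<lambda>g. frag_of (g \<circ> foldr f u)) (operator_sum f p)"
proof (induction p rule: frag_induction[OF subset_UNIV])
  case (2 x)
  then show ?case by (cases x) (simp add: word_monom_mult foldr_append_comp comp_def)
qed (simp_all add: left_diff_distrib frag_extend_diff)

lemma operator_sum_mult_eq_0:
  assumes "operator_sum f p = 0"
  shows "operator_sum f (q * p) = 0" "operator_sum f (p * q) = 0"
proof -
  show "operator_sum f (q * p) = 0"
  proof (induction q rule: frag_induction[OF subset_UNIV])
    case (2 x)
    then show ?case by (cases x) (simp add: operator_sum_mult_left assms)
  qed (simp_all add: left_diff_distrib)
  show "operator_sum f (p * q) = 0"
  proof (induction q rule: frag_induction[OF subset_UNIV])
    case (2 x)
    then show ?case by (cases x) (simp add: operator_sum_mult_right assms)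
  qed (simp_all add: right_diff_distrib)
qed

lemma ideal_operator_sum_kernel:
  "ideal {p \<in> carrier (free_algebra I). operator_sum f p = 0} (free_algebra I)" (is "ideal ?K _")
proof -
  interpret ring "free_algebra I" by (rule ring_free_algebra)
  have neg: "\<ominus>\<^bsub>free_algebra I\<^esub> q = 0 - q" if "q \<in> carrier (free_algebra I)" for q
    using free_algebra_a_minus[of 0 I q] that by (simp add: a_minus_def free_algebra_simps)
  have diff: "p - q \<in> ?K" if "p \<in> ?K" "q \<in> ?K" for p q
    using that by (simp add: free_algebra_diff_closed)
  have zero: "0 \<in> ?K" by (simp add: free_algebra_simps)
  show ?thesis
  proof (rule idealI[OF ring_axioms])
    show "subgroup ?K (add_monoid (free_algebra I))"
    proof (rule add.subgroupI)
      show "?K \<noteq> {}" using zero by blast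
    next
      fix q assume "q \<in> ?K" then show "\<ominus>\<^bsub>free_algebra I\<^esub> q \<in> ?K"
        using diff[OF zero, of q] neg by simp
    next
      fix p q assume "p \<in> ?K" "q \<in> ?K"
      then show "p \<oplus>\<^bsub>free_algebra I\<^esub> q \<in> ?K"
        using diff[of p "0 - q"] diff[OF zero, of q] by (simp add: free_algebra_simps(3))
    qed auto
  next
    fix p x assume "p \<in> ?K" "x \<in> carrier (free_algebra I)"
    then show "x \<otimes>\<^bsub>free_algebra I\<^esub> p \<in> ?K" "p \<otimes>\<^bsub>free_algebra I\<^esub> x \<in> ?K"
      using operator_sum_mult_eq_0[of f p x] m_closed[of x p] m_closed[of p x]
      by (simp_all add: free_algebra_simps(2))
  qed
qed

abbreviation hecke_word :: "'i set \<Rightarrow> ('i \<Rightarrow> 'i \<Rightarrow> nat) \<Rightarrow> 'i list \<Rightarrow> ('i free_word \<Rightarrow>\<^sub>0 int) set" where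
  "hecke_word I m \<equiv> word_prod (hecke0 I m) (hecke0_gen I m)"

lemma alternating_in_lists: "\<lbrakk>i \<in> I; j \<in> I\<rbrakk> \<Longrightarrow> alternating i j n \<in> lists I"
  by (auto simp: alternating_def in_lists_conv_set)

lemma hecke0_relators_closed: "hecke0_relators I m \<subseteq> carrier (free_algebra I)"
  unfolding hecke0_relators_def
  by (auto intro!: free_algebra_diff_closed simp: word_monom_closed alternating_in_lists)

lemma ideal_hecke0: "ideal (hecke0_ideal I m) (free_algebra I)"
  unfolding hecke0_ideal_def
  by (rule ring.genideal_ideal[OF ring_free_algebra hecke0_relators_closed])

lemma ring_hecke0: "ring (hecke0 I m)"
  unfolding hecke0_def by (rule ideal.quotient_is_ring[OF ideal_hecke0])

lemma hecke_word_eq_coset: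
  "u \<in> lists I \<Longrightarrow> hecke_word I m u = hecke0_ideal I m +>\<^bsub>free_algebra I\<^esub> word_monom u"
proof (induction u)
  case Nil
  then show ?case
    by (simp add: word_prod_def hecke0_def FactRing_def free_algebra_simps zero_free_word_def[symmetric])
next
  case (Cons i u)
  have "hecke_word I m (i # u) = hecke0_gen I m i \<otimes>\<^bsub>hecke0 I m\<^esub> hecke_word I m u"
    by (simp add: word_prod_def)
  also have "hecke_word I m u = hecke0_ideal I m +>\<^bsub>free_algebra I\<^esub> word_monom u"
    using Cons by simp
  also have "hecke0_gen I m i \<otimes>\<^bsub>hecke0 I m\<^esub> \<dots> = hecke0_ideal I m +>\<^bsub>free_algebra I\<^esub> word_monom (i # u)"
    using Cons.prems ideal.rcoset_mult_add[OF ideal_hecke0, of "word_monom [i]" I "word_monom u" m]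
    by (simp add: hecke0_gen_def hecke0_def FactRing_def word_monom_closed free_algebra_simps(2)
        word_monom_mult)
  finally show ?case .
qed

lemma hecke_word_eq_iff:
  assumes "u \<in> lists I" "v \<in> lists I"
  shows "hecke_word I m u = hecke_word I m v \<longleftrightarrow> word_monom u - word_monom v \<in> hecke0_ideal I m"
  using ring.quotient_eq_iff_same_a_r_cos[OF ring_free_algebra ideal_hecke0, of "word_monom u" I "word_monom v" m] assms
  by (simp add: hecke_word_eq_coset free_algebra_a_minus word_monom_closed)

lemma hecke_word_closed: "u \<in> lists I \<Longrightarrow> hecke_word I m u \<in> carrier (hecke0 I m)"
  unfolding hecke_word_eq_coset
  by (simp add: hecke0_def FactRing_def abelian_group.a_rcosetsI
      ring.is_abelian_group[OF ring_free_algebra] word_monom_closed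
      additive_subgroup.a_subset[OF ideal.axioms(1)[OF ideal_hecke0]])

lemma hecke_word_append:
  assumes "u \<in> lists I" "v \<in> lists I"
  shows "hecke_word I m (u @ v) = hecke_word I m u \<otimes>\<^bsub>hecke0 I m\<^esub> hecke_word I m v"
proof -
  let ?C = "\<lambda>u. hecke0_ideal I m +>\<^bsub>free_algebra I\<^esub> word_monom u"
  have "?C u \<otimes>\<^bsub>hecke0 I m\<^esub> ?C v = ?C (u @ v)"
    using ideal.rcoset_mult_add[OF ideal_hecke0, of "word_monom u" I "word_monom v" m] assms
    by (simp add: hecke0_def FactRing_def word_monom_closed free_algebra_simps(2) word_monom_mult)
  then show ?thesis using assms by (simp add: hecke_word_eq_coset)
qed

lemma hecke_word_relator:
  assumes "word_monom u - word_monom v \<in> hecke0_relators I m" "u \<in> lists I" "v \<in> lists I"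
  shows "hecke_word I m u = hecke_word I m v"
  using assms ring.genideal_self[OF ring_free_algebra hecke0_relators_closed, of I m]
  by (auto simp: hecke_word_eq_iff hecke0_ideal_def)

lemma hecke_word_square: "i \<in> I \<Longrightarrow> hecke_word I m [i, i] = hecke_word I m [i]"
  by (rule hecke_word_relator) (auto simp: hecke0_relators_def)

lemma hecke_word_braid_equiv:
  "braid_equiv I m u v \<Longrightarrow> hecke_word I m u = hecke_word I m v"
proof (induction rule: braid_equiv.induct)
  case (braid i j u v)
  then have "hecke_word I m (alternating i j (m i j)) = hecke_word I m (alternating j i (m i j))"
    by (intro hecke_word_relator) (auto simp: hecke0_relators_def alternating_in_lists)
  then show ?case using braid by (simp add: hecke_word_append alternating_in_lists)
qed auto

text \<open>
  The relators lie in the kernel of \<open>operator_sum f\<close>, hence so does the ideal, and the action of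
  a word depends only on its class in the 0-Hecke algebra.
\<close>

lemma hecke_word_faithful:
  assumes "\<And>i. i \<in> I \<Longrightarrow> f i \<circ> f i = f i"
    and "\<And>i j. \<lbrakk>i \<in> I; j \<in> I; i \<noteq> j\<rbrakk> \<Longrightarrow>
      foldr f (alternating i j (m i j)) = foldr f (alternating j i (m i j))"
    and "u \<in> lists I" "v \<in> lists I" "hecke_word I m u = hecke_word I m v"
  shows "foldr f u = foldr f v"
proof -
  let ?K = "{p \<in> carrier (free_algebra I). operator_sum f p = 0}"
  have "operator_sum f p = 0" if p: "p \<in> hecke0_relators I m" for p
  proof -
    consider i where "i \<in> I" "p = word_monom [i, i] - word_monom [i]"
      | i j where "i \<in> I" "j \<in> I" "i \<noteq> j"
        "p = word_monom (alternating i j (m i j)) - word_monom (alternating j i (m i j))"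
      using p unfolding hecke0_relators_def by blast
    then show ?thesis
    proof cases
      case 1
      then show ?thesis using assms(1) by (simp add: comp_def)
    next
      case 2
      then show ?thesis using assms(2)[of i j] by simp
    qed
  qed
  then have "hecke0_relators I m \<subseteq> ?K"
    using hecke0_relators_closed[of I m] by blast
  then have "hecke0_ideal I m \<subseteq> ?K"
    unfolding hecke0_ideal_def
    by (rule ring.genideal_minimal[OF ring_free_algebra ideal_operator_sum_kernel])
  then have "operator_sum f (word_monom u - word_monom v) = 0"
    using assms(3-5) by (auto simp: hecke_word_eq_iff)
  then have "frag_of (foldr f u) = frag_of (foldr f v)" by simp
  then have "Poly_Mapping.keys (frag_of (foldr f u)) = Poly_Mapping.keys (frag_of (foldr f v))"
    by (rule arg_cong)
  then show ?thesis by simp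
qed

section \<open>The basis elements of the 0-Hecke algebra\<close>

text \<open>
  Left multiplication by the generator \<open>T'\<^sub>i\<close> seen on vectors: \<open>s\<^sub>i\<close> is applied only if this makes
  the group element longer.
\<close>

definition demazure :: "('i \<Rightarrow> 'i \<Rightarrow> nat) \<Rightarrow> 'i \<Rightarrow> ('i \<Rightarrow> int) \<Rightarrow> 'i \<Rightarrow> int" where
  "demazure m i v = (if 0 < v i then reflect m i v else v)"

context simply_laced_coxeter_system begin

abbreviation T where "T \<equiv> hecke0_T W I s m"
abbreviation T_word where "T_word \<equiv> hecke_word I m"
abbreviation Hmult (infixl "\<odot>" 70) where "a \<odot> b \<equiv> a \<otimes>\<^bsub>hecke0 I m\<^esub> b"

text \<open>
  Left multiplication of a set \<open>S\<close> by \<open>{1, s\<^sub>i}\<close>. Starting from \<open>{1}\<close> and applying this along a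
  word gives the set of products of its subwords, the lower Bruhat interval of the Demazure
  product of the word. The idempotent and braid relations are immediate for these
  maps because \<open>{1, s\<^sub>i}\<close> is a subgroup and both sides of a braid relation multiply by
  the whole group generated by \<open>s\<^sub>i\<close> and \<open>s\<^sub>j\<close>.
\<close>

definition subproducts :: "'i \<Rightarrow> 'w set \<Rightarrow> 'w set" where
  "subproducts i S = {x \<in> carrier W. x \<in> S \<or> s i \<otimes> x \<in> S}"

lemma subproducts_iff: "x \<in> subproducts i S \<longleftrightarrow> x \<in> carrier W \<and> (x \<in> S \<or> s i \<otimes> x \<in> S)"
  by (simp add: subproducts_def)

lemma subproducts_square: "i \<in> I \<Longrightarrow> subproducts i \<circ> subproducts i = subproducts i"
  by (rule ext) (auto simp: subproducts_def simple_closed)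

lemma subproducts_braid:
  assumes "i \<in> I" "j \<in> I" "i \<noteq> j"
  shows "foldr subproducts (alternating i j (m i j)) = foldr subproducts (alternating j i (m i j))"
proof -
  consider "m i j = 2" | "m i j = 3" using simply_laced assms by blast
  then show ?thesis
  proof cases
    case 1
    then show ?thesis using assms simple_commute[OF assms]
      by (intro ext) (auto simp: subproducts_def simple_closed alternating_2)
  next
    case 2
    then show ?thesis using assms simple_braid[OF assms]
      by (intro ext) (auto simp: subproducts_def simple_closed alternating_3)
  qed
qed

lemma subproducts_eq:
  "\<lbrakk>u \<in> lists I; v \<in> lists I; T_word u = T_word v\<rbrakk> \<Longrightarrow> foldr subproducts u S = foldr subproducts v S"
  using hecke_word_faithful[of I subproducts m u v] subproducts_square subproducts_braid
  by presburger

lemma subproducts_subword: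
  assumes "u \<in> lists I" "x \<in> foldr subproducts u {\<one>}"
  obtains v where "v \<in> lists I" "length v \<le> length u" "length v = length u \<Longrightarrow> v = u" "wp v = x"
proof -
  have "\<exists>v\<in>lists I. length v \<le> length u \<and> (length v = length u \<longrightarrow> v = u) \<and> wp v = x"
    using assms
  proof (induction u arbitrary: x)
    case (Cons i u)
    then have i: "i \<in> I" "u \<in> lists I" and x: "x \<in> carrier W"
      and "x \<in> foldr subproducts u {\<one>} \<or> s i \<otimes> x \<in> foldr subproducts u {\<one>}"
      by (auto simp: subproducts_iff)
    then consider "x \<in> foldr subproducts u {\<one>}" | "s i \<otimes> x \<in> foldr subproducts u {\<one>}" by blast
    then show ?case
    proof cases
      case 1
      then obtain v where "v \<in> lists I" "length v \<le> length u" "wp v = x" using Cons.IH i by blast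
      then show ?thesis by (intro bexI[of _ v]) auto
    next
      case 2
      then obtain v where "v \<in> lists I" "length v \<le> length u" "length v = length u \<longrightarrow> v = u"
        "wp v = s i \<otimes> x" using Cons.IH i by blast
      then show ?thesis using i x by (intro bexI[of _ "i # v"]) auto
    qed
  qed (auto simp: lists.Nil)
  then show ?thesis using that by blast
qed

lemma subproducts_closed:
  "S \<subseteq> carrier W \<Longrightarrow> foldr subproducts u S \<subseteq> carrier W"
  by (induction u) (auto simp: subproducts_def)

lemma subproducts_mono: "S \<subseteq> S' \<Longrightarrow> foldr subproducts u S \<subseteq> foldr subproducts u S'"
  by (induction u) (auto simp: subproducts_def)

lemma subproducts_superset:
  "S \<subseteq> carrier W \<Longrightarrow> S \<subseteq> foldr subproducts u S"
  by (induction u) (auto simp: subproducts_def)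

lemma wp_in_subproducts: "u \<in> lists I \<Longrightarrow> wp u \<in> foldr subproducts u {\<one>}"
  by (induction u) (auto simp: subproducts_def simple_closed)

lemma T_red: assumes "red w u" shows "T w = T_word u"
proof -
  have "red w (SOME u. red w u)" using assms by (rule someI)
  then show ?thesis unfolding hecke0_T_def
    using matsumoto assms hecke_word_braid_equiv by blast
qed

lemma T_closed: "w \<in> carrier W \<Longrightarrow> T w \<in> carrier (hecke0 I m)"
  using ex_reduced T_red hecke_word_closed red_D(1) by metis

lemma hecke0_monoid: "monoid (hecke0 I m)"
  using ring_hecke0 by (rule ring.is_monoid)

lemma H_assoc:
  "\<lbrakk>a \<in> carrier (hecke0 I m); b \<in> carrier (hecke0 I m); c \<in> carrier (hecke0 I m)\<rbrakk>
    \<Longrightarrow> a \<odot> b \<odot> c = a \<odot> (b \<odot> c)"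
  by (rule monoid.m_assoc[OF hecke0_monoid])

lemma T_word_closed: "u \<in> lists I \<Longrightarrow> T_word u \<in> carrier (hecke0 I m)"
  by (rule hecke_word_closed)

lemma T_word_append: "\<lbrakk>u \<in> lists I; v \<in> lists I\<rbrakk> \<Longrightarrow> T_word (u @ v) = T_word u \<odot> T_word v"
  by (rule hecke_word_append)

lemma T_word_Cons:
  assumes "i \<in> I" "u \<in> lists I" shows "T_word (i # u) = T_word [i] \<odot> T_word u"
  using T_word_append[of "[i]" u] assms by simp

text \<open>
  The element \<open>y\<close> is the unique longest one among the products of subwords of \<open>u\<close>, since a proper
  subword of a reduced word of \<open>y\<close> is too short.
\<close>

lemma subproducts_T:
  assumes "x \<in> carrier W" "y \<in> carrier W" "u \<in> lists I" "T_word u = T y" "x \<in> foldr subproducts u {\<one>}"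
    "len y \<le> len x"
  shows "x = y"
proof -
  obtain v where v: "red y v" using ex_reduced assms(2) by blast
  have "x \<in> foldr subproducts v {\<one>}"
    using assms subproducts_eq[of u v] red_D[OF v] T_red[OF v] by simp
  then obtain v' where v': "v' \<in> lists I" "length v' \<le> length v" "length v' = length v \<Longrightarrow> v' = v" "wp v' = x"
    using subproducts_subword red_D[OF v] by blast
  have "length v = length v'" using v' len_wp_le[of v'] assms(6) red_D[OF v] by simp
  then show ?thesis using v' red_D[OF v] by simp
qed

lemma T_inject: assumes "x \<in> carrier W" "y \<in> carrier W" "T x = T y" shows "x = y"
proof -
  have *: "x = y" if c: "x \<in> carrier W" "y \<in> carrier W" "T x = T y" "len y \<le> len x" for x y
  proof -
    obtain u where u: "red x u" using ex_reduced[OF c(1)] .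
    have "x \<in> foldr subproducts u {\<one>}" using wp_in_subproducts[of u] red_D[OF u] by simp
    moreover have "T_word u = T y" by (rule HOL.trans[OF HOL.sym[OF T_red[OF u]] c(3)])
    ultimately show ?thesis using subproducts_T[OF c(1,2) red_D(1)[OF u]] c(4) by blast
  qed
  show ?thesis using *[of x y] *[of y x] assms by (metis nat_le_linear)
qed

lemma T_one: "T \<one> = \<one>\<^bsub>hecke0 I m\<^esub>"
proof -
  have "red \<one> []" by (simp add: reduced_expression_def)
  then show ?thesis using T_red by (metis word_prod_def foldr.simps(1) id_apply)
qed

lemma T_ascent:
  assumes "i \<in> I" "w \<in> carrier W" "len (s i \<otimes> w) = Suc (len w)"
  shows "T_word [i] \<odot> T w = T (s i \<otimes> w)"
proof -
  obtain u where u: "red w u" using ex_reduced assms by blast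
  then show ?thesis
    using T_red[OF u] T_red[OF red_Cons[OF u assms(1,3)]] assms red_D[OF u]
      hecke_word_append[of "[i]" I u m] by simp
qed

lemma T_descent:
  assumes "i \<in> I" "w \<in> carrier W" "len w = Suc (len (s i \<otimes> w))"
  shows "T_word [i] \<odot> T w = T w"
proof -
  obtain u where u: "red (s i \<otimes> w) u" using ex_reduced assms simple_closed by (meson m_closed)
  have uI: "u \<in> lists I" using red_D[OF u] by simp
  have "red w (i # u)" using red_Cons[OF u, of i] assms by simp
  then have T: "T w = T_word (i # u)" by (rule T_red)
  have "T_word [i] \<odot> T w = T_word ([i, i] @ u)"
    using T hecke_word_append[of "[i]" I "i # u" m] uI assms by simp
  also have "\<dots> = T_word ([i] @ u)"
    using hecke_word_append[of "[i,i]" I u m] hecke_word_append[of "[i]" I u m] uI assms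
      hecke_word_square[of i I m] by simp
  finally show ?thesis using T by simp
qed

lemma T_right_descent:
  assumes "i \<in> I" "w \<in> carrier W" "len (w \<otimes> s i) < len w"
  shows "T w \<odot> T_word [i] = T w"
proof -
  have si: "s i \<in> carrier W" using assms simple_closed by blast
  obtain u where u: "red (w \<otimes> s i) u" using ex_reduced assms si by (meson m_closed)
  have uI: "u \<in> lists I" using red_D[OF u] by simp
  have wu: "wp (u @ [i]) = w"
    using uI assms red_D[OF u] si simple_square[of i] by (simp add: wp_append m_assoc)
  moreover have "len (wp (u @ [i])) \<le> length (u @ [i])" using len_wp_le[of "u @ [i]"] uI assms by simp
  ultimately have "red w (u @ [i])"
    using assms uI red_D[OF u] by (auto simp: reduced_expression_def)
  then have T: "T w = T_word (u @ [i])" by (rule T_red)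
  have "T w \<odot> T_word [i] = T_word (u @ [i, i])"
    using T hecke_word_append[of "u @ [i]" I "[i]" m] uI assms by simp
  also have "\<dots> = T_word (u @ [i])"
    using hecke_word_append[of u I "[i,i]" m] hecke_word_append[of u I "[i]" m] uI assms
      hecke_word_square[of i I m] by simp
  finally show ?thesis using T by simp
qed

text \<open>
  Every product of generators with a basis element is a basis element, and its vector is obtained
  by a computation with integer vectors. All explicit values below come from this.
\<close>

lemma T_word_mult_T:
  assumes "u \<in> lists I" "y \<in> carrier W"
  obtains v where "v \<in> lists (set u)" "T_word u \<odot> T y = T (wp v \<otimes> y)"
    "vec (wp v \<otimes> y) = foldr (demazure m) u (vec y)"
proof -
  have "\<exists>v\<in>lists (set u). T_word u \<odot> T y = T (wp v \<otimes> y) \<and> vec (wp v \<otimes> y) = foldr (demazure m) u (vec y)"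
    using assms(1)
  proof (induction u)
    case Nil
    then show ?case using assms(2) T_closed[of y] 
      by (intro bexI[of _ "[]"]) (auto simp: word_prod_def monoid.l_one[OF hecke0_monoid])
  next
    case (Cons i u)
    then obtain v where v: "v \<in> lists (set u)" "T_word u \<odot> T y = T (wp v \<otimes> y)"
      "vec (wp v \<otimes> y) = foldr (demazure m) u (vec y)" and i: "i \<in> I" "u \<in> lists I" by auto
    have vI: "v \<in> lists I" using v i by (auto simp: in_lists_conv_set)
    let ?z = "wp v \<otimes> y"
    have z: "?z \<in> carrier W" using vI assms by simp
    have "T_word (i # u) \<odot> T y = T_word [i] \<odot> T ?z"
      using i v T_closed[OF assms(2)] by (simp add: T_word_Cons[of i u] H_assoc T_word_closed)
    moreover have "T_word [i] \<odot> T ?z = T (s i \<otimes> ?z) \<and> vec (s i \<otimes> ?z) = demazure m i (vec ?z)"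
      if "0 < vec ?z i"
      using that z i T_ascent ascent_iff vec_simple by (simp add: demazure_def)
    moreover have "T_word [i] \<odot> T ?z = T ?z \<and> vec ?z = demazure m i (vec ?z)"
      if "\<not> 0 < vec ?z i"
      using that z i T_descent ascent_iff len_simple_cases by (metis demazure_def)
    moreover have "s i \<otimes> ?z = wp (i # v) \<otimes> y"
      using i vI assms by (simp add: m_assoc simple_closed)
    moreover have "v \<in> lists (set (i # u))" "i # v \<in> lists (set (i # u))"
      using v by (auto simp: in_lists_conv_set)
    ultimately show ?case
      using v(3) by (cases "0 < vec ?z i") (metis foldr.simps(2) comp_apply)+
  qed
  then show ?thesis using that by blast
qed

lemma T_word_eq_T:
  assumes "u \<in> lists I"
  obtains v where "v \<in> lists (set u)" "v \<in> lists I" "T_word u = T (wp v)"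
    "vec (wp v) = foldr (demazure m) u rho"
proof -
  obtain v where v: "v \<in> lists (set u)" "T_word u \<odot> T \<one> = T (wp v \<otimes> \<one>)"
    "vec (wp v \<otimes> \<one>) = foldr (demazure m) u (vec \<one>)"
    using T_word_mult_T[OF assms one_closed] .
  have vI: "v \<in> lists I" using v(1) assms by (auto simp: in_lists_conv_set)
  show ?thesis
    using that[OF v(1) vI] v(2,3) vI T_one T_word_closed[OF assms]
    by (simp add: monoid.r_one[OF hecke0_monoid])
qed

section \<open>Longest elements\<close>

abbreviation w0 where "w0 \<equiv> longest_element W I s"

lemma generate_closed: "J \<subseteq> I \<Longrightarrow> generate W (s ` J) \<subseteq> carrier W"
  using generate_incl[of "s ` J"] simple_closed by blast

lemma T_absorb_left:
  assumes "J \<subseteq> I" "y \<in> carrier W" "\<forall>i\<in>J. vec y i < 0" "u \<in> lists J"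
  shows "T_word u \<odot> T y = T y"
  using assms(4)
proof (induction u)
  case Nil
  then show ?case using T_closed[OF assms(2)] by (simp add: word_prod_def monoid.l_one[OF hecke0_monoid])
next
  case (Cons i u)
  then have i: "i \<in> I" "u \<in> lists I" "i \<in> J" using assms lists_mono[OF assms(1)] by auto
  then have "T_word (i # u) \<odot> T y = T_word [i] \<odot> T y"
    using i Cons T_closed[OF assms(2)] by (simp add: T_word_Cons[of i u] H_assoc T_word_closed)
  then show ?case using T_descent[of i y] descent_iff[of y i] i assms by simp
qed

text \<open>
  Let \<open>w\<close> have maximal length in \<open>W\<^sub>J\<close>. Every \<open>j \<in> J\<close> is a descent of \<open>w\<close> on both
  sides, so \<open>T'\<^sub>w\<close> absorbs all generators from \<open>J\<close> on its right. An element \<open>y\<close> of \<open>W\<^sub>J\<close> for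
  which every \<open>j \<in> J\<close> is a left descent absorbs them on its left. The product of \<open>T'\<^sub>w\<close> and \<open>T'\<^sub>y\<close> is
  therefore equal to both, and \<open>w = y\<close>.
\<close>

lemma longest_element_char:
  assumes "J \<subseteq> I"
  shows longest_in: "w0 J \<in> generate W (s ` J)"
    and longest_max: "v \<in> generate W (s ` J) \<Longrightarrow> len v \<le> len (w0 J)"
    and longest_descent: "i \<in> J \<Longrightarrow> vec (w0 J) i < 0"
    and longest_eqI: "\<lbrakk>y \<in> generate W (s ` J); \<forall>i\<in>J. vec y i < 0\<rbrakk> \<Longrightarrow> w0 J = y"
proof -
  let ?WJ = "generate W (s ` J)"
  have sub: "?WJ \<subseteq> carrier W" using generate_closed assms .
  have fin: "finite ?WJ" using sub finite_group finite_subset by blast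
  have "\<one> \<in> ?WJ" by (rule generate.one)
  then have "Max (len ` ?WJ) \<in> len ` ?WJ" using fin by (intro Max_in) auto
  then obtain w where w: "w \<in> ?WJ" "len w = Max (len ` ?WJ)" by auto
  have desc: "vec x i < 0" if "x \<in> ?WJ" "\<forall>v\<in>?WJ. len v \<le> len x" "i \<in> J" for x i
  proof -
    have "s i \<otimes> x \<in> ?WJ" using that by (auto intro: generate.intros)
    then have "\<not> len (s i \<otimes> x) = Suc (len x)" using that by fastforce
    then have "len x = Suc (len (s i \<otimes> x))" using len_simple_cases[of i x] that assms sub by auto
    then show ?thesis using descent_iff[of x i] that assms sub by auto
  qed
  have max: "\<forall>v\<in>?WJ. len v \<le> len w" using w fin by simp
  have right: "T w \<odot> T_word u = T w" if "u \<in> lists J" for u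
    using that
  proof (induction u rule: rev_induct)
    case Nil
    then show ?case using T_closed sub w by (auto simp: word_prod_def monoid.r_one[OF hecke0_monoid])
  next
    case (snoc i u)
    then have i: "i \<in> I" "u \<in> lists I" "i \<in> J" using assms lists_mono[OF assms] by auto
    have wc: "w \<in> carrier W" using w sub by blast
    have "w \<otimes> s i \<in> ?WJ" using w i by (auto intro: generate.intros)
    then have "len (w \<otimes> s i) \<le> len w" using max by blast
    moreover obtain v where v: "v \<in> lists I" "wp v = w" using element_word wc by blast
    then have "even (len (w \<otimes> s i)) \<noteq> even (len w)"
      using even_len_wp[of v] even_len_wp[of "v @ [i]"] i by (simp add: wp_append simple_closed)
    then have "len (w \<otimes> s i) \<noteq> len w" by auto
    ultimately have "T w \<odot> T_word [i] = T w" using T_right_descent[of i w] i wc by simp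
    moreover have "T_word (u @ [i]) = T_word u \<odot> T_word [i]" using i by (intro hecke_word_append) auto
    then have "T w \<odot> T_word (u @ [i]) = T w \<odot> T_word u \<odot> T_word [i]"
      using H_assoc hecke_word_closed[of u I m] hecke_word_closed[of "[i]" I m] T_closed[OF wc] i by simp
    ultimately show ?case using snoc by simp
  qed
  have unique: "y = w" if y: "y \<in> ?WJ" "\<forall>i\<in>J. vec y i < 0" for y
  proof -
    have c: "y \<in> carrier W" "w \<in> carrier W" using y w sub by auto
    obtain u where u: "red y u" using ex_reduced c by blast
    obtain v where v: "red w v" using ex_reduced c by blast
    have J: "u \<in> lists J" "v \<in> lists J" using red_parabolic assms u v y w by blast+
    have "T w = T w \<odot> T_word u" using right J by simp
    also have "\<dots> = T_word v \<odot> T y" using T_red u v by simp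
    also have "\<dots> = T y" using T_absorb_left[OF assms c(1) y(2)] J by simp
    finally show ?thesis using T_inject c by metis
  qed
  have w0: "w0 J = w" unfolding longest_element_def
  proof (rule the_equality)
    show "w \<in> ?WJ \<and> (\<forall>v\<in>?WJ. len v \<le> len w)" using w max by blast
    show "y = w" if "y \<in> ?WJ \<and> (\<forall>v\<in>?WJ. len v \<le> len y)" for y
      using unique[of y] desc[of y] that by blast
  qed
  show "w0 J \<in> ?WJ" using w0 w by simp
  show "v \<in> ?WJ \<Longrightarrow> len v \<le> len (w0 J)" using w0 max by simp
  show "i \<in> J \<Longrightarrow> vec (w0 J) i < 0" using w0 w max desc by simp
  show "\<lbrakk>y \<in> ?WJ; \<forall>i\<in>J. vec y i < 0\<rbrakk> \<Longrightarrow> w0 J = y" using w0 unique by simp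
qed

lemma longest_closed: "J \<subseteq> I \<Longrightarrow> w0 J \<in> carrier W"
  using longest_in generate_closed by blast

lemma longest_empty: "w0 {} = \<one>"
  by (rule longest_eqI) (auto intro: generate.one)

text \<open>
  \<open>J\<close> can be read off from \<open>w\<^sub>0\<^sup>J\<close>: it is the set of letters of any reduced word. This makes
  the set \<open>K\<close> in the definition of the star operation unique.
\<close>

lemma longest_inject:
  assumes "J \<subseteq> I" "K \<subseteq> I" "w0 J = w0 K" shows "J = K"
proof -
  have *: "set u = J" if "J \<subseteq> I" "red (w0 J) u" for J u
  proof
    show "set u \<subseteq> J" using red_parabolic[OF that(1) longest_in[OF that(1)] that(2)]
      by (auto simp: in_lists_conv_set)
    show "J \<subseteq> set u"
    proof
      fix i assume i: "i \<in> J"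
      then have iI: "i \<in> I" using that by auto
      have c: "w0 J \<in> carrier W" using longest_closed that by blast
      have d: "len (w0 J) = Suc (len (s i \<otimes> w0 J))"
        using descent_iff[OF c iI] longest_descent[OF that(1) i] by simp
      obtain v where v: "red (s i \<otimes> w0 J) v" using ex_reduced c iI simple_closed by (meson m_closed)
      have "red (w0 J) (i # v)" using red_Cons[OF v iI] d c iI by simp
      then have "set u = set (i # v)" using matsumoto that(2) set_braid_equiv by blast
      then show "i \<in> set u" by simp
    qed
  qed
  obtain u where u: "red (w0 J) u" using ex_reduced[OF longest_closed[OF assms(1)]] .
  have "set u = J" using *[OF assms(1) u] .
  moreover have "set u = K" using *[OF assms(2)] u unfolding assms(3) .
  ultimately show ?thesis by simp
qed

lemma longest_element_vec:
  assumes "J \<subseteq> I" "u \<in> lists J" "\<forall>i\<in>J. foldr (demazure m) u rho i < 0"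
  shows "vec (w0 J) = foldr (demazure m) u rho"
proof -
  have uI: "u \<in> lists I" using assms(2) lists_mono[OF assms(1)] by (rule rev_subsetD)
  obtain v where v: "v \<in> lists (set u)" "vec (wp v) = foldr (demazure m) u rho"
    using T_word_eq_T[OF uI] .
  have vJ: "v \<in> lists J" using v(1) assms(2) by (auto simp: in_lists_conv_set)
  have "wp v \<in> generate W (s ` J)" using generate_eq_words[OF assms(1)] vJ by simp
  then have "w0 J = wp v" using longest_eqI[OF assms(1), of "wp v"] v(2) assms(3) by simp
  then show ?thesis using v(2) by simp
qed

lemma hecke_star_eqI:
  assumes "z \<in> carrier W" "T x \<odot> T y = T z" shows "hecke_star W I s m x y = z"
  unfolding hecke_star_def using assms T_inject by (intro the_equality) auto

lemma subset_star_eqI: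
  assumes "K \<subseteq> I" "T (w0 J1 \<otimes> w0 I) \<odot> T (w0 J2 \<otimes> w0 I) = T (w0 K \<otimes> w0 I)"
  shows "subset_star W I s m J1 J2 = K"
proof -
  have I: "w0 I \<in> carrier W" using longest_closed by blast
  have "hecke_star W I s m (w0 J1 \<otimes> w0 I) (w0 J2 \<otimes> w0 I) = w0 K \<otimes> w0 I"
    using assms longest_closed I by (intro hecke_star_eqI) auto
  then show ?thesis unfolding subset_star_def Let_def
    using assms(1) longest_inject longest_closed I by (intro the_equality) auto
qed

section \<open>Systems whose longest element acts as minus one\<close>

context
  assumes longest_neg: "vec (w0 I) = (\<lambda>k. - rho k)"
begin

lemma vec_mult_longest:
  assumes "w \<in> carrier W" shows "vec (w \<otimes> w0 I) = (\<lambda>k. - vec w k)"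
proof -
  obtain u where u: "u \<in> lists I" "wp u = w" using element_word[OF assms] .
  have neg: "foldr (reflect m) u (\<lambda>k. - v k) = (\<lambda>k. - foldr (reflect m) u v k)" for v
    by (induction u) (auto simp: reflect_def)
  have "vec (w \<otimes> w0 I) = foldr (reflect m) u (\<lambda>k. - rho k)"
    using vec_mult[OF u(1) longest_closed[OF subset_refl]] u(2) longest_neg by simp
  then show ?thesis using neg[of rho] vec_wp[OF u(1)] u(2) by simp
qed

text \<open>
  Right multiplication by \<open>w\<^sub>0\<^sup>I\<close> negates vectors, so it exchanges ascents and descents. Climbing
  from \<open>v\<close> to \<open>w\<^sub>0\<^sup>K\<close> inside \<open>W\<^sub>K\<close> thus becomes a length additive factorization of
  \<open>v w\<^sub>0\<^sup>I\<close> that ends in \<open>w\<^sub>0\<^sup>K w\<^sub>0\<^sup>I\<close>.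
\<close>

lemma T_mult_longest_factor:
  assumes "K \<subseteq> I" "v \<in> generate W (s ` K)"
  shows "\<exists>a\<in>lists I. T (v \<otimes> w0 I) = T_word a \<odot> T (w0 K \<otimes> w0 I)"
  using assms(2)
proof (induction "len (w0 K) - len v" arbitrary: v rule: less_induct)
  case less
  have vc: "v \<in> carrier W" using less.prems generate_closed assms(1) by blast
  have c: "w0 K \<in> carrier W" "w0 I \<in> carrier W" using longest_closed assms(1) by auto
  show ?case
  proof (cases "\<forall>i\<in>K. vec v i < 0")
    case True
    then have "w0 K = v" using longest_eqI assms(1) less.prems by blast
    then show ?thesis using T_closed[of "w0 K \<otimes> w0 I"] c
      by (intro bexI[of _ "[]"]) (auto simp: word_prod_def monoid.l_one[OF hecke0_monoid])
  next
    case False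
    then obtain i where i: "i \<in> K" "\<not> vec v i < 0" by blast
    have iI: "i \<in> I" using i assms by blast
    have up: "len (s i \<otimes> v) = Suc (len v)"
      using descent_iff[OF vc iI] len_simple_cases[OF iI vc] i by simp
    have g: "s i \<otimes> v \<in> generate W (s ` K)" using less.prems i by (auto intro: generate.intros)
    have "len (w0 K) - len (s i \<otimes> v) < len (w0 K) - len v"
      using longest_max[OF assms(1) g] up by simp
    then obtain a where a: "a \<in> lists I" "T (s i \<otimes> v \<otimes> w0 I) = T_word a \<odot> T (w0 K \<otimes> w0 I)"
      using less.hyps g by blast
    let ?x = "s i \<otimes> v \<otimes> w0 I"
    have x: "?x \<in> carrier W" "s i \<otimes> ?x = v \<otimes> w0 I"
      using vc c iI by (simp_all add: m_assoc simple_closed)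
    have "vec ?x i = vec v i"
      using vec_mult_longest[of "s i \<otimes> v"] vc iI by (simp add: vec_simple simple_closed reflect_def)
    moreover have "0 < vec v i" using ascent_iff[OF vc iI] up by simp
    ultimately have "T_word [i] \<odot> T ?x = T (v \<otimes> w0 I)"
      using T_ascent[of i ?x] ascent_iff[of ?x i] iI x by simp
    then have "T (v \<otimes> w0 I) = T_word ([i] @ a) \<odot> T (w0 K \<otimes> w0 I)"
      using a iI hecke_word_append[of "[i]" I a m] H_assoc hecke_word_closed[of "[i]" I m]
        hecke_word_closed[of a I m] T_closed[of "w0 K \<otimes> w0 I"] c by simp
    then show ?thesis using a iI by (intro bexI[of _ "[i] @ a"]) auto
  qed
qed

lemma generate_mono_simple: "J \<subseteq> K \<Longrightarrow> generate W (s ` J) \<subseteq> generate W (s ` K)"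
  by (intro mono_generate image_mono)

text \<open>
  Shrinking \<open>K1\<close> and \<open>K2\<close> only inserts letters into a word for the product. The longest element
  of the group is a product of a subword before the insertion, hence also after it, and so the
  product remains the longest element.
\<close>

lemma subset_star_empty_mono:
  assumes K: "K1 \<subseteq> I" "K2 \<subseteq> I" and J: "J1 \<subseteq> K1" "J2 \<subseteq> K2"
    and top: "T (w0 K1 \<otimes> w0 I) \<odot> T (w0 K2 \<otimes> w0 I) = T (w0 I)"
  shows "subset_star W I s m J1 J2 = {}"
proof -
  have I: "w0 I \<in> carrier W" using longest_closed by blast
  have Jin: "w0 J1 \<in> generate W (s ` K1)" "w0 J2 \<in> generate W (s ` K2)"
    using longest_in[of J1] longest_in[of J2] generate_mono_simple J K by blast+
  obtain a where a: "a \<in> lists I" "T (w0 J1 \<otimes> w0 I) = T_word a \<odot> T (w0 K1 \<otimes> w0 I)"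
    using T_mult_longest_factor[OF K(1) Jin(1)] by blast
  obtain b where b: "b \<in> lists I" "T (w0 J2 \<otimes> w0 I) = T_word b \<odot> T (w0 K2 \<otimes> w0 I)"
    using T_mult_longest_factor[OF K(2) Jin(2)] by blast
  have kc: "w0 K1 \<otimes> w0 I \<in> carrier W" "w0 K2 \<otimes> w0 I \<in> carrier W"
    using longest_closed K I by auto
  obtain u1 where u1: "red (w0 K1 \<otimes> w0 I) u1" using ex_reduced[OF kc(1)] .
  obtain u2 where u2: "red (w0 K2 \<otimes> w0 I) u2" using ex_reduced[OF kc(2)] .
  obtain u0 where u0: "red (w0 I) u0" using ex_reduced[OF I] .
  note u = u1 u2 u0
  have uI: "u1 \<in> lists I" "u2 \<in> lists I" "u0 \<in> lists I" using u red_D(1) by blast+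
  let ?u = "(a @ u1) @ b @ u2"
  have Tu: "T (w0 J1 \<otimes> w0 I) \<odot> T (w0 J2 \<otimes> w0 I) = T_word ?u"
    using a b uI T_red[OF u(1)] T_red[OF u(2)] by (simp add: T_word_append T_word_closed H_assoc monoid.m_closed[OF hecke0_monoid])
  have "T_word u0 = T_word (u1 @ u2)"
    using top T_red u uI by (simp add: hecke_word_append)
  then have "w0 I \<in> foldr subproducts (u1 @ u2) {\<one>}"
    using subproducts_eq[of u0 "u1 @ u2"] wp_in_subproducts[of u0] uI red_D(2)[OF u(3)] by simp
  also have "\<dots> \<subseteq> foldr subproducts ?u {\<one>}"
  proof -
    let ?S = "foldr subproducts u2 {\<one>}"
    have "?S \<subseteq> foldr subproducts b ?S"
      using subproducts_superset subproducts_closed by simp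
    then have "foldr subproducts u1 ?S \<subseteq> foldr subproducts u1 (foldr subproducts b ?S)"
      by (rule subproducts_mono)
    also have "\<dots> \<subseteq> foldr subproducts a \<dots>"
      using subproducts_superset subproducts_closed by simp
    finally show ?thesis by simp
  qed
  finally have mem: "w0 I \<in> foldr subproducts ?u {\<one>}" .
  have uu: "?u \<in> lists I" using uI a b by simp
  obtain v where vI: "v \<in> lists I" and Tv: "T_word ?u = T (wp v)" using T_word_eq_T[OF uu] .
  have "wp v \<in> generate W (s ` I)" unfolding generated[symmetric] by (rule wp_closed[OF vI])
  then have "len (wp v) \<le> len (w0 I)" by (rule longest_max[OF subset_refl])
  then have "w0 I = wp v" using subproducts_T[OF I _ uu Tv mem] vI by simp
  then show ?thesis using Tu Tv I by (intro subset_star_eqI) (auto simp: longest_empty)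
qed

lemma T_word_eq_T_mult_longest:
  assumes "J \<subseteq> I" "u \<in> lists I" "foldr (demazure m) u rho = (\<lambda>k. - vec (w0 J) k)"
  shows "T_word u = T (w0 J \<otimes> w0 I)"
proof -
  have c: "w0 J \<in> carrier W" "w0 I \<in> carrier W" using longest_closed assms(1) by auto
  obtain v where v: "v \<in> lists I" "T_word u = T (wp v)" "vec (wp v) = foldr (demazure m) u rho"
    using T_word_eq_T[OF assms(2)] .
  then have "vec (wp v) = vec (w0 J \<otimes> w0 I)" using assms(3) vec_mult_longest c by simp
  then have "wp v = w0 J \<otimes> w0 I" using vec_inject v(1) c by simp
  then show ?thesis using v(2) by simp
qed

text \<open>
  Two evaluations of the same word \<open>u\<close> determine the product: from \<open>rho\<close> it must lead to the
  vector of \<open>w\<^sub>0\<^sup>J w\<^sub>0\<^sup>I\<close> with \<open>J = J1\<close>, and from the vector for \<open>J2\<close> to that for the result \<open>K\<close>.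
\<close>

lemma T_mult_T_by_vec:
  assumes J: "J1 \<subseteq> I" "J2 \<subseteq> I" "K \<subseteq> I" and u: "u \<in> lists I"
    and u1: "foldr (demazure m) u rho = (\<lambda>k. - vec (w0 J1) k)"
    and u2: "foldr (demazure m) u (\<lambda>k. - vec (w0 J2) k) = (\<lambda>k. - vec (w0 K) k)"
  shows "T (w0 J1 \<otimes> w0 I) \<odot> T (w0 J2 \<otimes> w0 I) = T (w0 K \<otimes> w0 I)"
proof -
  have c: "w0 J2 \<in> carrier W" "w0 K \<in> carrier W" "w0 I \<in> carrier W" using longest_closed J by auto
  let ?y = "w0 J2 \<otimes> w0 I"
  have y: "?y \<in> carrier W" using c by simp
  obtain v where v: "v \<in> lists (set u)" "T_word u \<odot> T ?y = T (wp v \<otimes> ?y)"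
    "vec (wp v \<otimes> ?y) = foldr (demazure m) u (vec ?y)"
    using T_word_mult_T[OF u y] .
  have vI: "v \<in> lists I" using v(1) u by (auto simp: in_lists_conv_set)
  have "vec (wp v \<otimes> ?y) = vec (w0 K \<otimes> w0 I)" using v(3) u2 vec_mult_longest c by simp
  then have "wp v \<otimes> ?y = w0 K \<otimes> w0 I" using vec_inject vI c by simp
  then show ?thesis using v(2) T_word_eq_T_mult_longest[OF J(1) u u1] by simp
qed

end

end

section \<open>Computations in type $E_7$\<close>

(* The literal 1 is a node label and has to match the evaluation rules syntactically. *)
declare One_nat_def [simp del]

definition vec7 :: "int \<Rightarrow> int \<Rightarrow> int \<Rightarrow> int \<Rightarrow> int \<Rightarrow> int \<Rightarrow> int \<Rightarrow> nat \<Rightarrow> int" where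
  "vec7 a b c d e f g k =
     (if k = 1 then a else if k = 2 then b else if k = 3 then c else if k = 4 then d
      else if k = 5 then e else if k = 6 then f else if k = 7 then g else 0)"

lemma E7_nodes_eq: "E7_nodes = {1, 2, 3, 4, 5, 6, 7}"
  unfolding E7_nodes_def by (simp add: atLeastAtMost_insertL[symmetric] numeral_eq_Suc)

lemma E7_nodes_iff:
  "k \<in> E7_nodes \<longleftrightarrow> k = 1 \<or> k = 2 \<or> k = 3 \<or> k = 4 \<or> k = 5 \<or> k = 6 \<or> k = 7"
  by (simp add: E7_nodes_eq)

lemma uminus_vec7: "(\<lambda>k. - vec7 a b c d e f g k) = vec7 (-a) (-b) (-c) (-d) (-e) (-f) (-g)"
  by (rule ext) (simp add: vec7_def)

lemma rho_vec7: "(\<lambda>k. of_bool (k \<in> E7_nodes)) = vec7 1 1 1 1 1 1 1"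
proof (rule ext)
  fix k show "of_bool (k \<in> E7_nodes) = vec7 1 1 1 1 1 1 1 k"
    by (cases "k \<in> E7_nodes") (auto simp: vec7_def E7_nodes_eq)
qed

lemma vec7_nth [simp]:
  "vec7 a b c d e f g 1 = a" "vec7 a b c d e f g 2 = b" "vec7 a b c d e f g 3 = c"
  "vec7 a b c d e f g 4 = d" "vec7 a b c d e f g 5 = e" "vec7 a b c d e f g 6 = f"
  "vec7 a b c d e f g 7 = g"
  by (simp_all add: vec7_def)

lemma demazure_vec7:
  "demazure E7_matrix 1 (vec7 a b c d e f g) =
     (if 0 < a then vec7 (-a) b (c + a) d e f g else vec7 a b c d e f g)"
  "demazure E7_matrix 2 (vec7 a b c d e f g) =
     (if 0 < b then vec7 a (-b) c (d + b) e f g else vec7 a b c d e f g)"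
  "demazure E7_matrix 3 (vec7 a b c d e f g) =
     (if 0 < c then vec7 (a + c) b (-c) (d + c) e f g else vec7 a b c d e f g)"
  "demazure E7_matrix 4 (vec7 a b c d e f g) =
     (if 0 < d then vec7 a (b + d) (c + d) (-d) (e + d) f g else vec7 a b c d e f g)"
  "demazure E7_matrix 5 (vec7 a b c d e f g) =
     (if 0 < e then vec7 a b c (d + e) (-e) (f + e) g else vec7 a b c d e f g)"
  "demazure E7_matrix 6 (vec7 a b c d e f g) =
     (if 0 < f then vec7 a b c d (e + f) (-f) (g + f) else vec7 a b c d e f g)"
  "demazure E7_matrix 7 (vec7 a b c d e f g) =
     (if 0 < g then vec7 a b c d e (f + g) (-g) else vec7 a b c d e f g)"
  by (rule ext, simp add: demazure_def reflect_def vec7_def E7_matrix_def E7_edges_def)+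

lemmas eval_simps = demazure_vec7 uminus_vec7 E7_nodes_iff

text \<open>
  The connected proper subsets fall into two classes. \<open>E7_big\<close> consists of the subdiagrams
  of types \<open>D\<^sub>6\<close>, \<open>E\<^sub>6\<close>, \<open>D\<^sub>5\<close>, \<open>D\<^sub>5\<close> that occur in nontrivial star products. The
  subdiagrams in \<open>E7_small\<close>, of types \<open>A\<^sub>6\<close>, \<open>A\<^sub>5\<close>, \<open>D\<^sub>4\<close>, \<open>A\<^sub>4\<close>, are the maximal
  ones among the others.
\<close>

definition E7_small :: "nat set \<Rightarrow> bool" where
  "E7_small J \<longleftrightarrow> J \<subseteq> {1, 3, 4, 5, 6, 7} \<or> J \<subseteq> {2, 4, 5, 6, 7} \<or> J \<subseteq> {2, 3, 4, 5} \<or> J \<subseteq> {1, 2, 3, 4}"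

definition E7_big :: "nat set set" where
  "E7_big = {{2, 3, 4, 5, 6, 7}, {1, 2, 3, 4, 5, 6}, {2, 3, 4, 5, 6}, {1, 2, 3, 4, 5}}"

lemma E7_small_not_big: "E7_small J \<Longrightarrow> J \<notin> E7_big"
  unfolding E7_small_def E7_big_def by (intro notI) (elim insertE emptyE; simp)

locale E7_system = finite_coxeter_system W E7_nodes s E7_matrix
  for W :: "('w, 'b) monoid_scheme" (structure) and s

sublocale E7_system \<subseteq> simply_laced_coxeter_system W E7_nodes s E7_matrix
  by unfold_locales (simp add: E7_matrix_def)

context E7_system begin

lemma longest_eval:
  assumes "J \<subseteq> E7_nodes" "u \<in> lists J" "foldr (demazure E7_matrix) u (vec7 1 1 1 1 1 1 1) = v" "\<forall>i\<in>J. v i < 0"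
  shows "vec (w0 J) = v"
  using longest_element_vec[of J u] assms by (simp add: rho_vec7)

abbreviation hecke_mult (infixl "\<odot>" 70) where "a \<odot> b \<equiv> a \<otimes>\<^bsub>hecke0 E7_nodes E7_matrix\<^esub> b"

abbreviation star :: "nat set \<Rightarrow> nat set \<Rightarrow> nat set" where
  "star \<equiv> subset_star W E7_nodes s E7_matrix"

abbreviation TX where "TX J \<equiv> T (w0 J \<otimes> w0 E7_nodes)"

text \<open>
  The word, like those in the other evaluations of longest elements, was found by firing positive
  coordinates, starting from \<open>rho\<close>, until none was left in \<open>J\<close>.
\<close>

lemma longest_neg: "vec (w0 E7_nodes) = (\<lambda>k. - rho k)"
  unfolding fun_cong[OF rho_vec7] uminus_vec7
  by (rule longest_eval[of _ "[7, 6, 5, 4, 3, 2, 4, 5, 6, 7, 1, 3, 4, 5, 6, 2, 4, 5, 3, 4, 1, 3, 2, 4, 5, 6, 7, 1, 3, 4, 5, 6, 2, 4, 5, 3, 4, 1, 3, 2, 4, 5, 6, 2, 4, 5, 3, 4, 1, 3, 2, 4, 5, 3, 4, 1, 3, 2, 4, 1, 3, 2, 1]"])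
    (simp_all add: eval_simps E7_nodes_eq)

lemma TX_eval:
  assumes "J1 \<subseteq> E7_nodes" "J2 \<subseteq> E7_nodes" "K \<subseteq> E7_nodes" "u \<in> lists E7_nodes"
    and "foldr (demazure E7_matrix) u (vec7 1 1 1 1 1 1 1) = (\<lambda>k. - vec (w0 J1) k)"
    and "foldr (demazure E7_matrix) u (\<lambda>k. - vec (w0 J2) k) = (\<lambda>k. - vec (w0 K) k)"
  shows "TX J1 \<odot> TX J2 = TX K"
  using T_mult_T_by_vec[OF longest_neg] assms by (simp add: rho_vec7)

lemma vec_longest_empty: "vec (w0 {}) = vec7 1 1 1 1 1 1 1"
  by (simp add: longest_empty rho_vec7)

lemma vec_longest:
  shows "vec (w0 {2, 3, 4, 5, 6, 7}) = vec7 16 (-1) (-1) (-1) (-1) (-1) (-1)"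
    and "vec (w0 {1, 2, 3, 4, 5, 6}) = vec7 (-1) (-1) (-1) (-1) (-1) (-1) 17"
    and "vec (w0 {2, 3, 4, 5, 6}) = vec7 11 (-1) (-1) (-1) (-1) (-1) 9"
    and "vec (w0 {1, 2, 3, 4, 5}) = vec7 (-1) (-1) (-1) (-1) (-1) 11 1"
    and "vec (w0 {1, 3, 4, 5, 6, 7}) = vec7 (-1) 13 (-1) (-1) (-1) (-1) (-1)"
    and "vec (w0 {2, 4, 5, 6, 7}) = vec7 1 (-1) 9 (-1) (-1) (-1) (-1)"
    and "vec (w0 {1, 2, 3, 4}) = vec7 (-1) (-1) (-1) (-1) 7 1 1"
    and "vec (w0 {2, 3, 4, 5}) = vec7 7 (-1) (-1) (-1) (-1) 7 1"
    and "vec (w0 {3, 4, 5}) = vec7 4 5 (-1) (-1) (-1) 4 1"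
    and "vec (w0 {2, 5, 7}) = vec7 1 (-1) 1 3 (-1) 3 (-1)"
    and "vec (w0 {4}) = vec7 1 2 2 (-1) 2 1 1"
proof -
  show "vec (w0 {2, 3, 4, 5, 6, 7}) = vec7 16 (-1) (-1) (-1) (-1) (-1) (-1)"
    by (rule longest_eval[of _ "[7, 6, 5, 4, 3, 2, 4, 5, 6, 7, 6, 5, 4, 3, 2, 4, 5, 6, 5, 4, 3, 2, 4, 5, 4, 3, 2, 4, 3, 2]"]) (simp_all add: eval_simps)
  show "vec (w0 {1, 2, 3, 4, 5, 6}) = vec7 (-1) (-1) (-1) (-1) (-1) (-1) 17"
    by (rule longest_eval[of _ "[1, 3, 4, 5, 6, 2, 4, 5, 3, 4, 1, 3, 2, 4, 5, 6, 2, 4, 5, 3, 4, 1, 3, 2, 4, 5, 3, 4, 1, 3, 2, 4, 1, 3, 2, 1]"]) (simp_all add: eval_simps)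
  show "vec (w0 {2, 3, 4, 5, 6}) = vec7 11 (-1) (-1) (-1) (-1) (-1) 9"
    by (rule longest_eval[of _ "[6, 5, 4, 3, 2, 4, 5, 6, 5, 4, 3, 2, 4, 5, 4, 3, 2, 4, 3, 2]"]) (simp_all add: eval_simps)
  show "vec (w0 {1, 2, 3, 4, 5}) = vec7 (-1) (-1) (-1) (-1) (-1) 11 1"
    by (rule longest_eval[of _ "[2, 4, 5, 3, 4, 1, 3, 2, 4, 5, 3, 4, 1, 3, 2, 4, 1, 3, 2, 1]"]) (simp_all add: eval_simps)
  show "vec (w0 {1, 3, 4, 5, 6, 7}) = vec7 (-1) 13 (-1) (-1) (-1) (-1) (-1)"
    by (rule longest_eval[of _ "[1, 3, 4, 5, 6, 7, 1, 3, 4, 5, 6, 1, 3, 4, 5, 1, 3, 4, 1, 3, 1]"]) (simp_all add: eval_simps)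
  show "vec (w0 {2, 4, 5, 6, 7}) = vec7 1 (-1) 9 (-1) (-1) (-1) (-1)"
    by (rule longest_eval[of _ "[2, 4, 5, 6, 7, 2, 4, 5, 6, 2, 4, 5, 2, 4, 2]"]) (simp_all add: eval_simps)
  show "vec (w0 {1, 2, 3, 4}) = vec7 (-1) (-1) (-1) (-1) 7 1 1"
    by (rule longest_eval[of _ "[3, 4, 1, 3, 2, 4, 1, 3, 2, 1]"]) (simp_all add: eval_simps)
  show "vec (w0 {2, 3, 4, 5}) = vec7 7 (-1) (-1) (-1) (-1) 7 1"
    by (rule longest_eval[of _ "[5, 4, 3, 2, 4, 5, 4, 3, 2, 4, 3, 2]"]) (simp_all add: eval_simps)
  show "vec (w0 {3, 4, 5}) = vec7 4 5 (-1) (-1) (-1) 4 1"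
    by (rule longest_eval[of _ "[3, 4, 5, 3, 4, 3]"]) (simp_all add: eval_simps)
  show "vec (w0 {2, 5, 7}) = vec7 1 (-1) 1 3 (-1) 3 (-1)"
    by (rule longest_eval[of _ "[7, 5, 2]"]) (simp_all add: eval_simps)
  show "vec (w0 {4}) = vec7 1 2 2 (-1) 2 1 1"
    by (rule longest_eval[of _ "[4]"]) (simp_all add: eval_simps)
qed

text \<open>
  In each of the following evaluations \<open>?u\<close> is a reduced word of \<open>w\<^sub>0\<^sup>J w\<^sub>0\<^sup>I\<close>, where \<open>J\<close> is the
  left factor. It was found by firing negative coordinates from the vector of that element
  until \<open>rho\<close> was reached. The pairs are those with a nonempty result and enough of the large
  pairs with an empty result to dominate all the others.
\<close>

lemma star_234567:
  shows "TX {2, 3, 4, 5, 6, 7} \<odot> TX {2, 3, 4, 5, 6, 7} = TX {2, 5, 7}"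
    and "TX {2, 3, 4, 5, 6, 7} \<odot> TX {1, 2, 3, 4, 5, 6} = TX {3, 4, 5}"
    and "TX {2, 3, 4, 5, 6, 7} \<odot> TX {2, 3, 4, 5, 6} = TX {}"
    and "TX {2, 3, 4, 5, 6, 7} \<odot> TX {1, 2, 3, 4, 5} = TX {}"
    and "TX {2, 3, 4, 5, 6, 7} \<odot> TX {1, 3, 4, 5, 6, 7} = TX {}"
    and "TX {2, 3, 4, 5, 6, 7} \<odot> TX {2, 4, 5, 6, 7} = TX {}"
proof -
  let ?u = "[1, 3, 4, 2, 5, 4, 3, 1, 6, 5, 4, 2, 3, 4, 5, 6, 7, 6, 5, 4, 2, 3, 1, 4, 3, 5, 4, 2, 6, 5, 4, 3, 1]"
  have u: "foldr (demazure E7_matrix) ?u (vec7 1 1 1 1 1 1 1) = (\<lambda>k. - vec (w0 {2, 3, 4, 5, 6, 7}) k)"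
    by (simp add: eval_simps vec_longest vec_longest_empty)
  show "TX {2, 3, 4, 5, 6, 7} \<odot> TX {2, 3, 4, 5, 6, 7} = TX {2, 5, 7}"
    by (rule TX_eval[OF _ _ _ _ u]) (simp_all add: eval_simps vec_longest vec_longest_empty)
  show "TX {2, 3, 4, 5, 6, 7} \<odot> TX {1, 2, 3, 4, 5, 6} = TX {3, 4, 5}"
    by (rule TX_eval[OF _ _ _ _ u]) (simp_all add: eval_simps vec_longest vec_longest_empty)
  show "TX {2, 3, 4, 5, 6, 7} \<odot> TX {2, 3, 4, 5, 6} = TX {}"
    by (rule TX_eval[OF _ _ _ _ u]) (simp_all add: eval_simps vec_longest vec_longest_empty)
  show "TX {2, 3, 4, 5, 6, 7} \<odot> TX {1, 2, 3, 4, 5} = TX {}"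
    by (rule TX_eval[OF _ _ _ _ u]) (simp_all add: eval_simps vec_longest vec_longest_empty)
  show "TX {2, 3, 4, 5, 6, 7} \<odot> TX {1, 3, 4, 5, 6, 7} = TX {}"
    by (rule TX_eval[OF _ _ _ _ u]) (simp_all add: eval_simps vec_longest vec_longest_empty)
  show "TX {2, 3, 4, 5, 6, 7} \<odot> TX {2, 4, 5, 6, 7} = TX {}"
    by (rule TX_eval[OF _ _ _ _ u]) (simp_all add: eval_simps vec_longest vec_longest_empty)
qed

lemma star_123456:
  shows "TX {1, 2, 3, 4, 5, 6} \<odot> TX {1, 2, 3, 4, 5, 6} = TX {2, 3, 4, 5}"
    and "TX {1, 2, 3, 4, 5, 6} \<odot> TX {2, 3, 4, 5, 6, 7} = TX {3, 4, 5}"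
    and "TX {1, 2, 3, 4, 5, 6} \<odot> TX {2, 3, 4, 5, 6} = TX {4}"
    and "TX {1, 2, 3, 4, 5, 6} \<odot> TX {1, 2, 3, 4, 5} = TX {4}"
    and "TX {1, 2, 3, 4, 5, 6} \<odot> TX {1, 3, 4, 5, 6, 7} = TX {}"
    and "TX {1, 2, 3, 4, 5, 6} \<odot> TX {2, 4, 5, 6, 7} = TX {}"
    and "TX {1, 2, 3, 4, 5, 6} \<odot> TX {1, 2, 3, 4} = TX {}"
    and "TX {1, 2, 3, 4, 5, 6} \<odot> TX {2, 3, 4, 5} = TX {}"
proof -
  let ?u = "[7, 6, 5, 4, 2, 3, 1, 4, 3, 5, 4, 2, 6, 5, 4, 3, 1, 7, 6, 5, 4, 2, 3, 4, 5, 6, 7]"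
  have u: "foldr (demazure E7_matrix) ?u (vec7 1 1 1 1 1 1 1) = (\<lambda>k. - vec (w0 {1, 2, 3, 4, 5, 6}) k)"
    by (simp add: eval_simps vec_longest vec_longest_empty)
  show "TX {1, 2, 3, 4, 5, 6} \<odot> TX {1, 2, 3, 4, 5, 6} = TX {2, 3, 4, 5}"
    by (rule TX_eval[OF _ _ _ _ u]) (simp_all add: eval_simps vec_longest vec_longest_empty)
  show "TX {1, 2, 3, 4, 5, 6} \<odot> TX {2, 3, 4, 5, 6, 7} = TX {3, 4, 5}"
    by (rule TX_eval[OF _ _ _ _ u]) (simp_all add: eval_simps vec_longest vec_longest_empty)
  show "TX {1, 2, 3, 4, 5, 6} \<odot> TX {2, 3, 4, 5, 6} = TX {4}"
    by (rule TX_eval[OF _ _ _ _ u]) (simp_all add: eval_simps vec_longest vec_longest_empty)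
  show "TX {1, 2, 3, 4, 5, 6} \<odot> TX {1, 2, 3, 4, 5} = TX {4}"
    by (rule TX_eval[OF _ _ _ _ u]) (simp_all add: eval_simps vec_longest vec_longest_empty)
  show "TX {1, 2, 3, 4, 5, 6} \<odot> TX {1, 3, 4, 5, 6, 7} = TX {}"
    by (rule TX_eval[OF _ _ _ _ u]) (simp_all add: eval_simps vec_longest vec_longest_empty)
  show "TX {1, 2, 3, 4, 5, 6} \<odot> TX {2, 4, 5, 6, 7} = TX {}"
    by (rule TX_eval[OF _ _ _ _ u]) (simp_all add: eval_simps vec_longest vec_longest_empty)
  show "TX {1, 2, 3, 4, 5, 6} \<odot> TX {1, 2, 3, 4} = TX {}"
    by (rule TX_eval[OF _ _ _ _ u]) (simp_all add: eval_simps vec_longest vec_longest_empty)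
  show "TX {1, 2, 3, 4, 5, 6} \<odot> TX {2, 3, 4, 5} = TX {}"
    by (rule TX_eval[OF _ _ _ _ u]) (simp_all add: eval_simps vec_longest vec_longest_empty)
qed

lemma star_23456:
  shows "TX {2, 3, 4, 5, 6} \<odot> TX {1, 2, 3, 4, 5, 6} = TX {4}"
    and "TX {2, 3, 4, 5, 6} \<odot> TX {2, 3, 4, 5, 6, 7} = TX {}"
proof -
  let ?u = "[1, 3, 4, 2, 5, 4, 3, 1, 6, 5, 4, 2, 3, 4, 5, 6, 7, 6, 5, 4, 2, 3, 1, 4, 3, 5, 4, 2, 6, 5, 4, 3, 1, 7, 6, 5, 4, 2, 3, 4, 5, 6, 7]"
  have u: "foldr (demazure E7_matrix) ?u (vec7 1 1 1 1 1 1 1) = (\<lambda>k. - vec (w0 {2, 3, 4, 5, 6}) k)"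
    by (simp add: eval_simps vec_longest vec_longest_empty)
  show "TX {2, 3, 4, 5, 6} \<odot> TX {1, 2, 3, 4, 5, 6} = TX {4}"
    by (rule TX_eval[OF _ _ _ _ u]) (simp_all add: eval_simps vec_longest vec_longest_empty)
  show "TX {2, 3, 4, 5, 6} \<odot> TX {2, 3, 4, 5, 6, 7} = TX {}"
    by (rule TX_eval[OF _ _ _ _ u]) (simp_all add: eval_simps vec_longest vec_longest_empty)
qed

lemma star_12345:
  shows "TX {1, 2, 3, 4, 5} \<odot> TX {1, 2, 3, 4, 5, 6} = TX {4}"
    and "TX {1, 2, 3, 4, 5} \<odot> TX {2, 3, 4, 5, 6, 7} = TX {}"
    and "TX {1, 2, 3, 4, 5} \<odot> TX {1, 2, 3, 4, 5} = TX {}"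
proof -
  let ?u = "[6, 5, 4, 2, 3, 1, 4, 3, 5, 4, 2, 6, 5, 4, 3, 1, 7, 6, 5, 4, 2, 3, 1, 4, 3, 5, 4, 2, 6, 5, 4, 3, 1, 7, 6, 5, 4, 2, 3, 4, 5, 6, 7]"
  have u: "foldr (demazure E7_matrix) ?u (vec7 1 1 1 1 1 1 1) = (\<lambda>k. - vec (w0 {1, 2, 3, 4, 5}) k)"
    by (simp add: eval_simps vec_longest vec_longest_empty)
  show "TX {1, 2, 3, 4, 5} \<odot> TX {1, 2, 3, 4, 5, 6} = TX {4}"
    by (rule TX_eval[OF _ _ _ _ u]) (simp_all add: eval_simps vec_longest vec_longest_empty)
  show "TX {1, 2, 3, 4, 5} \<odot> TX {2, 3, 4, 5, 6, 7} = TX {}"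
    by (rule TX_eval[OF _ _ _ _ u]) (simp_all add: eval_simps vec_longest vec_longest_empty)
  show "TX {1, 2, 3, 4, 5} \<odot> TX {1, 2, 3, 4, 5} = TX {}"
    by (rule TX_eval[OF _ _ _ _ u]) (simp_all add: eval_simps vec_longest vec_longest_empty)
qed

lemma star_134567:
  shows "TX {1, 3, 4, 5, 6, 7} \<odot> TX {2, 3, 4, 5, 6, 7} = TX {}"
    and "TX {1, 3, 4, 5, 6, 7} \<odot> TX {1, 2, 3, 4, 5, 6} = TX {}"
    and "TX {1, 3, 4, 5, 6, 7} \<odot> TX {1, 3, 4, 5, 6, 7} = TX {}"
proof -
  let ?u = "[2, 4, 3, 1, 5, 4, 2, 3, 4, 5, 6, 5, 4, 2, 3, 1, 4, 3, 5, 4, 2, 7, 6, 5, 4, 2, 3, 1, 4, 3, 5, 4, 2, 6, 5, 4, 3, 7, 6, 5, 4, 2]"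
  have u: "foldr (demazure E7_matrix) ?u (vec7 1 1 1 1 1 1 1) = (\<lambda>k. - vec (w0 {1, 3, 4, 5, 6, 7}) k)"
    by (simp add: eval_simps vec_longest vec_longest_empty)
  show "TX {1, 3, 4, 5, 6, 7} \<odot> TX {2, 3, 4, 5, 6, 7} = TX {}"
    by (rule TX_eval[OF _ _ _ _ u]) (simp_all add: eval_simps vec_longest vec_longest_empty)
  show "TX {1, 3, 4, 5, 6, 7} \<odot> TX {1, 2, 3, 4, 5, 6} = TX {}"
    by (rule TX_eval[OF _ _ _ _ u]) (simp_all add: eval_simps vec_longest vec_longest_empty)
  show "TX {1, 3, 4, 5, 6, 7} \<odot> TX {1, 3, 4, 5, 6, 7} = TX {}"
    by (rule TX_eval[OF _ _ _ _ u]) (simp_all add: eval_simps vec_longest vec_longest_empty)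
qed

lemma star_24567:
  shows "TX {2, 4, 5, 6, 7} \<odot> TX {2, 3, 4, 5, 6, 7} = TX {}"
    and "TX {2, 4, 5, 6, 7} \<odot> TX {1, 2, 3, 4, 5, 6} = TX {}"
proof -
  let ?u = "[1, 3, 1, 4, 2, 3, 4, 5, 4, 2, 3, 1, 4, 3, 6, 5, 4, 2, 3, 1, 4, 3, 5, 4, 6, 5, 7, 6, 5, 4, 2, 3, 1, 4, 3, 5, 4, 2, 6, 5, 4, 3, 1, 7, 6, 5, 4, 3]"
  have u: "foldr (demazure E7_matrix) ?u (vec7 1 1 1 1 1 1 1) = (\<lambda>k. - vec (w0 {2, 4, 5, 6, 7}) k)"
    by (simp add: eval_simps vec_longest vec_longest_empty)
  show "TX {2, 4, 5, 6, 7} \<odot> TX {2, 3, 4, 5, 6, 7} = TX {}"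
    by (rule TX_eval[OF _ _ _ _ u]) (simp_all add: eval_simps vec_longest vec_longest_empty)
  show "TX {2, 4, 5, 6, 7} \<odot> TX {1, 2, 3, 4, 5, 6} = TX {}"
    by (rule TX_eval[OF _ _ _ _ u]) (simp_all add: eval_simps vec_longest vec_longest_empty)
qed

lemma star_1234:
  shows "TX {1, 2, 3, 4} \<odot> TX {1, 2, 3, 4, 5, 6} = TX {}"
proof -
  let ?u = "[5, 4, 2, 3, 1, 4, 3, 5, 4, 2, 6, 5, 4, 2, 3, 1, 4, 3, 5, 4, 2, 6, 5, 4, 3, 1, 7, 6, 5, 4, 2, 3, 1, 4, 3, 5, 4, 2, 6, 5, 4, 3, 1, 7, 6, 5, 4, 2, 3, 4, 5, 6, 7]"
  have u: "foldr (demazure E7_matrix) ?u (vec7 1 1 1 1 1 1 1) = (\<lambda>k. - vec (w0 {1, 2, 3, 4}) k)"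
    by (simp add: eval_simps vec_longest vec_longest_empty)
  show "TX {1, 2, 3, 4} \<odot> TX {1, 2, 3, 4, 5, 6} = TX {}"
    by (rule TX_eval[OF _ _ _ _ u]) (simp_all add: eval_simps vec_longest vec_longest_empty)
qed

lemma star_2345:
  shows "TX {2, 3, 4, 5} \<odot> TX {1, 2, 3, 4, 5, 6} = TX {}"
proof -
  let ?u = "[1, 3, 4, 2, 5, 4, 3, 1, 6, 5, 4, 2, 3, 1, 4, 3, 5, 4, 2, 6, 5, 4, 3, 1, 7, 6, 5, 4, 2, 3, 1, 4, 3, 5, 4, 2, 6, 5, 4, 3, 1, 7, 6, 5, 4, 2, 3, 4, 5, 6, 7]"
  have u: "foldr (demazure E7_matrix) ?u (vec7 1 1 1 1 1 1 1) = (\<lambda>k. - vec (w0 {2, 3, 4, 5}) k)"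
    by (simp add: eval_simps vec_longest vec_longest_empty)
  show "TX {2, 3, 4, 5} \<odot> TX {1, 2, 3, 4, 5, 6} = TX {}"
    by (rule TX_eval[OF _ _ _ _ u]) (simp_all add: eval_simps vec_longest vec_longest_empty)
qed

lemma star_eqI:
  "\<lbrakk>TX J1 \<odot> TX J2 = TX K; K \<subseteq> E7_nodes\<rbrakk> \<Longrightarrow> star J1 J2 = K"
  by (rule subset_star_eqI)

definition star_trivial :: "nat set \<Rightarrow> nat set \<Rightarrow> bool" where
  "star_trivial K1 K2 \<longleftrightarrow> K1 \<subseteq> E7_nodes \<and> K2 \<subseteq> E7_nodes \<and> TX K1 \<odot> TX K2 = TX {}"

lemma star_trivial_mono:
  assumes "star_trivial K1 K2" "J1 \<subseteq> K1" "J2 \<subseteq> K2"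
  shows "star J1 J2 = {}"
proof (rule subset_star_empty_mono[OF longest_neg])
  show "TX K1 \<odot> TX K2 = T (w0 E7_nodes)"
    using assms longest_closed[OF subset_refl] by (simp add: star_trivial_def longest_empty)
qed (use assms in \<open>auto simp: star_trivial_def\<close>)

lemma star_trivial:
  "star_trivial {1, 3, 4, 5, 6, 7} {2, 3, 4, 5, 6, 7}"
  "star_trivial {2, 3, 4, 5, 6, 7} {1, 3, 4, 5, 6, 7}"
  "star_trivial {1, 3, 4, 5, 6, 7} {1, 2, 3, 4, 5, 6}"
  "star_trivial {1, 2, 3, 4, 5, 6} {1, 3, 4, 5, 6, 7}"
  "star_trivial {1, 3, 4, 5, 6, 7} {1, 3, 4, 5, 6, 7}"
  "star_trivial {2, 4, 5, 6, 7} {2, 3, 4, 5, 6, 7}"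
  "star_trivial {2, 3, 4, 5, 6, 7} {2, 4, 5, 6, 7}"
  "star_trivial {2, 4, 5, 6, 7} {1, 2, 3, 4, 5, 6}"
  "star_trivial {1, 2, 3, 4, 5, 6} {2, 4, 5, 6, 7}"
  "star_trivial {2, 3, 4, 5, 6} {2, 3, 4, 5, 6, 7}"
  "star_trivial {2, 3, 4, 5, 6, 7} {2, 3, 4, 5, 6}"
  "star_trivial {2, 3, 4, 5} {1, 2, 3, 4, 5, 6}"
  "star_trivial {1, 2, 3, 4, 5, 6} {2, 3, 4, 5}"
  "star_trivial {1, 2, 3, 4, 5} {2, 3, 4, 5, 6, 7}"
  "star_trivial {2, 3, 4, 5, 6, 7} {1, 2, 3, 4, 5}"
  "star_trivial {1, 2, 3, 4, 5} {1, 2, 3, 4, 5}"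
  "star_trivial {1, 2, 3, 4} {1, 2, 3, 4, 5, 6}"
  "star_trivial {1, 2, 3, 4, 5, 6} {1, 2, 3, 4}"
  unfolding star_trivial_def
  by (simp_all add: E7_nodes_iff star_234567 star_123456 star_23456 star_12345 star_134567 star_24567 star_1234 star_2345)

lemma star_big_values:
  "star {2, 3, 4, 5, 6, 7} {2, 3, 4, 5, 6, 7} = {2, 5, 7}"
  "star {2, 3, 4, 5, 6, 7} {1, 2, 3, 4, 5, 6} = {3, 4, 5}"
  "star {2, 3, 4, 5, 6, 7} {2, 3, 4, 5, 6} = {}"
  "star {2, 3, 4, 5, 6, 7} {1, 2, 3, 4, 5} = {}"
  "star {1, 2, 3, 4, 5, 6} {2, 3, 4, 5, 6, 7} = {3, 4, 5}"
  "star {1, 2, 3, 4, 5, 6} {1, 2, 3, 4, 5, 6} = {2, 3, 4, 5}"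
  "star {1, 2, 3, 4, 5, 6} {2, 3, 4, 5, 6} = {4}"
  "star {1, 2, 3, 4, 5, 6} {1, 2, 3, 4, 5} = {4}"
  "star {2, 3, 4, 5, 6} {2, 3, 4, 5, 6, 7} = {}"
  "star {2, 3, 4, 5, 6} {1, 2, 3, 4, 5, 6} = {4}"
  "star {2, 3, 4, 5, 6} {2, 3, 4, 5, 6} = {}"
  "star {2, 3, 4, 5, 6} {1, 2, 3, 4, 5} = {}"
  "star {1, 2, 3, 4, 5} {2, 3, 4, 5, 6, 7} = {}"
  "star {1, 2, 3, 4, 5} {1, 2, 3, 4, 5, 6} = {4}"
  "star {1, 2, 3, 4, 5} {2, 3, 4, 5, 6} = {}"
  "star {1, 2, 3, 4, 5} {1, 2, 3, 4, 5} = {}"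
  apply (rule star_eqI[OF star_234567(1)], simp add: E7_nodes_iff)
  apply (rule star_eqI[OF star_234567(2)], simp add: E7_nodes_iff)
  apply (rule star_eqI[OF star_234567(3)], simp add: E7_nodes_iff)
  apply (rule star_eqI[OF star_234567(4)], simp add: E7_nodes_iff)
  apply (rule star_eqI[OF star_123456(2)], simp add: E7_nodes_iff)
  apply (rule star_eqI[OF star_123456(1)], simp add: E7_nodes_iff)
  apply (rule star_eqI[OF star_123456(3)], simp add: E7_nodes_iff)
  apply (rule star_eqI[OF star_123456(4)], simp add: E7_nodes_iff)
  apply (rule star_eqI[OF star_23456(2)], simp add: E7_nodes_iff)
  apply (rule star_eqI[OF star_23456(1)], simp add: E7_nodes_iff)
  apply (rule star_trivial_mono[of "{2, 3, 4, 5, 6}" "{2, 3, 4, 5, 6, 7}"]; simp add: star_trivial)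
  apply (rule star_trivial_mono[of "{2, 3, 4, 5, 6, 7}" "{1, 2, 3, 4, 5}"]; simp add: star_trivial)
  apply (rule star_eqI[OF star_12345(2)], simp add: E7_nodes_iff)
  apply (rule star_eqI[OF star_12345(1)], simp add: E7_nodes_iff)
  apply (rule star_trivial_mono[of "{1, 2, 3, 4, 5}" "{2, 3, 4, 5, 6, 7}"]; simp add: star_trivial)
  apply (rule star_eqI[OF star_12345(3)], simp add: E7_nodes_iff)
  done

text \<open>
  Every pair with one small member lies below a pair from the table. The table is symmetric, so
  one statement serves both factors.
\<close>

lemma star_trivial_small:
  assumes J1: "E7_small J1" and J2: "J2 \<in> E7_big \<or> E7_small J2"
  shows "\<exists>K1 K2. J1 \<subseteq> K1 \<and> J2 \<subseteq> K2 \<and> star_trivial K1 K2 \<and> star_trivial K2 K1"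
proof -
  have sub: "{2, 4, 5, 6, 7} \<subseteq> {2, 3, 4, 5, 6, 7::nat}" "{2, 3, 4, 5} \<subseteq> {2, 3, 4, 5, 6::nat}"
    "{2, 3, 4, 5} \<subseteq> {2, 3, 4, 5, 6, 7::nat}" "{2, 3, 4, 5} \<subseteq> {1, 2, 3, 4, 5, 6::nat}"
    "{1, 2, 3, 4} \<subseteq> {1, 2, 3, 4, 5::nat}" "{1, 2, 3, 4} \<subseteq> {1, 2, 3, 4, 5, 6::nat}" by auto
  have "J2 \<subseteq> {2, 3, 4, 5, 6, 7} \<or> J2 \<subseteq> {1, 2, 3, 4, 5, 6} \<or> J2 \<subseteq> {1, 3, 4, 5, 6, 7}"
    using J2
  proof
    assume "J2 \<in> E7_big"
    then show ?thesis unfolding E7_big_def by (elim insertE emptyE) simp_all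
  next
    assume "E7_small J2"
    then show ?thesis unfolding E7_small_def by (meson sub subset_trans)
  qed
  then show ?thesis using J1 unfolding E7_small_def
    by (elim disjE; meson star_trivial sub subset_trans)
qed

end

section \<open>Connected subsets of the diagram\<close>

text \<open>
  A path from inside \<open>A\<close> to outside leaves \<open>A\<close> along some edge. In the diagram of type $E_7$, a tree,
  this forces the nodes next to a cut to be present.
\<close>

lemma coxeter_connected_cut:
  assumes "coxeter_connected m J" "a \<in> J" "a \<in> A" "b \<in> J" "b \<notin> A"
  obtains i j where "i \<in> J" "i \<in> A" "j \<in> J" "j \<notin> A" "(i, j) \<in> coxeter_edges m"
proof -
  have "(a, b) \<in> (coxeter_edges m \<inter> J \<times> J)\<^sup>*"
    using assms by (auto simp: coxeter_connected_def)
  then have "b \<notin> A \<longrightarrow> (\<exists>i j. i \<in> J \<and> i \<in> A \<and> j \<in> J \<and> j \<notin> A \<and> (i, j) \<in> coxeter_edges m)"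
    by (induction rule: rtrancl_induct) (use assms in blast)+
  then show ?thesis using that assms by blast
qed

lemma E7_coxeter_edges: "(i, j) \<in> coxeter_edges E7_matrix \<longleftrightarrow> (i, j) \<in> E7_edges \<or> (j, i) \<in> E7_edges"
  by (auto simp: coxeter_edges_def E7_matrix_def E7_edges_def)

lemma E7_connected_cases:
  assumes "J \<subset> E7_nodes" "coxeter_connected E7_matrix J"
  shows "J \<in> E7_big \<or> E7_small J"
proof -
  have J: "J \<subseteq> {1, 2, 3, 4, 5, 6, 7}" "J \<noteq> {1, 2, 3, 4, 5, 6, 7}"
    using assms(1) by (auto simp: E7_nodes_eq)
  have cut2: "4 \<in> J" if "2 \<in> J" "k \<in> J" "k \<noteq> 2" for k
    using coxeter_connected_cut[OF assms(2), of 2 "{2}" k] that by (auto simp: E7_coxeter_edges E7_edges_def)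
  have cut1: "3 \<in> J" if "1 \<in> J" "k \<in> J" "k \<noteq> 1" for k
    using coxeter_connected_cut[OF assms(2), of 1 "{1}" k] that by (auto simp: E7_coxeter_edges E7_edges_def)
  have cut7: "6 \<in> J" if "7 \<in> J" "k \<in> J" "k \<noteq> 7" for k
    using coxeter_connected_cut[OF assms(2), of 7 "{7}" k] that by (auto simp: E7_coxeter_edges E7_edges_def)
  have cut67: "5 \<in> J" if kl: "l \<in> J" "l \<in> {6, 7}" "k \<in> J" "k \<notin> {6, 7}" for k l
  proof -
    obtain i j where "i \<in> J" "i \<in> {6, 7}" "j \<in> J" "j \<notin> {6, 7}" "(i, j) \<in> coxeter_edges E7_matrix"
      using coxeter_connected_cut[OF assms(2) kl] .
    then show ?thesis by (auto simp: E7_coxeter_edges E7_edges_def)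
  qed
  consider "2 \<notin> J" | "2 \<in> J" "4 \<notin> J" | "2 \<in> J" "4 \<in> J" "3 \<notin> J" | "2 \<in> J" "4 \<in> J" "3 \<in> J" "5 \<notin> J"
    | "{2, 3, 4, 5} \<subseteq> J" "6 \<notin> J" | "{2, 3, 4, 5, 6} \<subseteq> J" by blast
  then show ?thesis
  proof cases
    case 1
    then have "J \<subseteq> {1, 3, 4, 5, 6, 7}" using J(1) by blast
    then show ?thesis by (simp add: E7_small_def)
  next
    case 2
    then have "J \<subseteq> {2, 4, 5, 6, 7}" using cut2 by blast
    then show ?thesis by (simp add: E7_small_def)
  next
    case 3
    then have "1 \<notin> J" using cut1[of 2] by auto
    then have "J \<subseteq> {2, 4, 5, 6, 7}" using J(1) 3 by blast
    then show ?thesis by (simp add: E7_small_def)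
  next
    case 4
    then have "6 \<notin> J" "7 \<notin> J" using cut67[of 6 2] cut67[of 7 2] by auto
    then have "J \<subseteq> {1, 2, 3, 4}" using J(1) 4 by blast
    then show ?thesis by (simp add: E7_small_def)
  next
    case 5
    then have "7 \<notin> J" using cut7[of 2] by auto
    then have upper: "J \<subseteq> {1, 2, 3, 4, 5}" using J(1) 5 by blast
    show ?thesis
    proof (cases "1 \<in> J")
      case True
      then have "J = {1, 2, 3, 4, 5}" using 5 upper by (intro equalityI) simp_all
      then show ?thesis by (simp add: E7_big_def)
    next
      case False
      then have "J \<subseteq> {2, 3, 4, 5}" using upper by blast
      then show ?thesis by (simp add: E7_small_def)
    qed
  next
    case 6
    have "J = {2, 3, 4, 5, 6, 7} \<or> J = {1, 2, 3, 4, 5, 6} \<or> J = {2, 3, 4, 5, 6}"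
    proof (cases "1 \<in> J")
      case True
      then have lower: "{1, 2, 3, 4, 5, 6} \<subseteq> J" using 6 by simp
      then have "7 \<notin> J" using J by (metis insert_subset subset_antisym)
      then have "J \<subseteq> {1, 2, 3, 4, 5, 6}" using J(1) by blast
      then show ?thesis using subset_antisym[OF _ lower] by simp
    next
      case False
      then have upper: "J \<subseteq> {2, 3, 4, 5, 6, 7}" using J(1) by blast
      show ?thesis
      proof (cases "7 \<in> J")
        case True
        then have "{2, 3, 4, 5, 6, 7} \<subseteq> J" using 6 by simp
        then show ?thesis using subset_antisym[OF upper] by simp
      next
        case False
        then have "J \<subseteq> {2, 3, 4, 5, 6}" using upper by blast
        then show ?thesis using subset_antisym[OF _ 6] by simp
      qed
    qed
    then show ?thesis unfolding E7_big_def by (elim disjE) simp_all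
  qed
qed

theorem mainTheorem6:
  fixes W :: "('w, 'b) monoid_scheme" and s :: "nat \<Rightarrow> 'w" and J1 J2 :: "nat set"
  assumes "finite_coxeter_system W E7_nodes s E7_matrix"
    and "J1 \<subset> E7_nodes" and "coxeter_connected E7_matrix J1"
    and "J2 \<subset> E7_nodes" and "coxeter_connected E7_matrix J2"
  shows "subset_star W E7_nodes s E7_matrix J1 J2 =
    (if J1 = E7_nodes - {1} \<and> J2 = E7_nodes - {1} then {2, 5, 7}
     else if J1 = E7_nodes - {7} \<and> J2 = E7_nodes - {7} then {2, 3, 4, 5}
     else if {J1, J2} = {E7_nodes - {1}, E7_nodes - {7}} then {3, 4, 5}
     else if {J1, J2} = {E7_nodes - {7}, E7_nodes - {1, 7}} then {4}
     else if {J1, J2} = {E7_nodes - {7}, E7_nodes - {6, 7}} then {4}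
     else {})"
proof -
  interpret E7_system W s unfolding E7_system_def by (rule assms(1))
  define P Q R S :: "nat set" where PQRS:
    "P = {2, 3, 4, 5, 6, 7}" "Q = {1, 2, 3, 4, 5, 6}" "R = {2, 3, 4, 5, 6}" "S = {1, 2, 3, 4, 5}"
  have nodes: "E7_nodes - {1} = P" "E7_nodes - {7} = Q" "E7_nodes - {1, 7} = R" "E7_nodes - {6, 7} = S"
    by (auto simp: E7_nodes_eq PQRS)
  have E7_big: "E7_big = {P, Q, R, S}" by (simp add: E7_big_def PQRS)
  have neq: "P \<noteq> Q" "P \<noteq> R" "P \<noteq> S" "Q \<noteq> R" "Q \<noteq> S" "R \<noteq> S"
    by (simp_all add: set_eq_subset PQRS)
  note vals = star_big_values[folded PQRS]
  have cases: "J1 \<in> E7_big \<or> E7_small J1" "J2 \<in> E7_big \<or> E7_small J2"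
    by (fact E7_connected_cases[OF assms(2,3)], fact E7_connected_cases[OF assms(4,5)])
  show ?thesis
  proof (cases "E7_small J1 \<or> E7_small J2")
    case True
    then have "\<exists>K1 K2. J1 \<subseteq> K1 \<and> J2 \<subseteq> K2 \<and> star_trivial K1 K2"
      using star_trivial_small[of J1 J2] star_trivial_small[of J2 J1] cases by blast
    then have "star J1 J2 = {}" using star_trivial_mono by blast
    moreover have "J1 \<notin> E7_big \<or> J2 \<notin> E7_big" using True E7_small_not_big by blast
    ultimately show ?thesis unfolding nodes E7_big by (elim disjE) (simp_all add: doubleton_eq_iff)
  next
    case False
    then have "J1 \<in> {P, Q, R, S}" "J2 \<in> {P, Q, R, S}" using cases E7_big by simp_all
    then show ?thesis unfolding nodes
      by (elim insertE emptyE) (simp_all add: vals neq neq[symmetric] doubleton_eq_iff)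
  qed
qed

end
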